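(* Let $n,m,\delta$ be integers with $n \leq \delta \leq m \leq 3\delta-5$. Let $G$ be a bipartite graph with bipartition $(X,Y)$, where $|X| = n \geq 2$, $|Y| = m$, and every vertex $x \in X$ has degree $d(x) \geq \delta$. If $G$ is 2-connected, then $G$ contains a cycle of length $2n$, i.e., a cycle that contains every vertex of $X$. *)

theory Defs
  imports Main
begin

definition simple_graph :: "'a set \<Rightarrow> ('a \<Rightarrow> 'a \<Rightarrow> bool) \<Rightarrow> bool" where
  "simple_graph V E \<longleftrightarrow> finite V \<and> (\<forall>u v. E u v \<longrightarrow> u \<in> V \<and> v \<in> V \<and> u \<noteq> v \<and> E v u)"

definition bipartite_graph :: "'a set \<Rightarrow> 'a set \<Rightarrow> ('a \<Rightarrow> 'a \<Rightarrow> bool) \<Rightarrow> bool" where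
  "bipartite_graph X Y E \<longleftrightarrow> simple_graph (X \<union> Y) E \<and> X \<inter> Y = {} \<and>
     (\<forall>u v. E u v \<longrightarrow> (u \<in> X \<and> v \<in> Y) \<or> (u \<in> Y \<and> v \<in> X))"

definition degree :: "('a \<Rightarrow> 'a \<Rightarrow> bool) \<Rightarrow> 'a \<Rightarrow> nat" where
  "degree E v = card {w. E v w}"

definition connected_on :: "'a set \<Rightarrow> ('a \<Rightarrow> 'a \<Rightarrow> bool) \<Rightarrow> bool" where
  "connected_on S E \<longleftrightarrow>
     (\<forall>u\<in>S. \<forall>v\<in>S. (\<lambda>a b. E a b \<and> a \<in> S \<and> b \<in> S)\<^sup>*\<^sup>* u v)"

definition two_connected :: "'a set \<Rightarrow> ('a \<Rightarrow> 'a \<Rightarrow> bool) \<Rightarrow> bool" where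
  "two_connected V E \<longleftrightarrow> card V \<ge> 3 \<and> connected_on V E \<and>
     (\<forall>v\<in>V. connected_on (V - {v}) E)"

definition is_cycle :: "'a set \<Rightarrow> ('a \<Rightarrow> 'a \<Rightarrow> bool) \<Rightarrow> 'a list \<Rightarrow> bool" where
  "is_cycle V E c \<longleftrightarrow> length c \<ge> 3 \<and> distinct c \<and> set c \<subseteq> V \<and>
     (\<forall>i < length c - 1. E (c ! i) (c ! Suc i)) \<and> E (last c) (hd c)"

end

theory Submission
  imports Defs
begin

text \<open>
  Take a cycle \<open>C\<close> with the largest number \<open>k\<close> of vertices of \<open>X\<close> and suppose that it misses some.
  If vertices of \<open>X\<close> pairwise have no common neighbour off \<open>C\<close>, then \<open>m \<le> 3\<delta> - 5\<close> and \<open>k < \<delta>\<close>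
  force their degrees into \<open>C\<close> to be large. By 2-connectedness some path \<open>R\<close> through a missed vertex
  \<open>x\<close> joins two vertices of \<open>C\<close>; let \<open>u\<close>, \<open>u'\<close> be the next vertices of \<open>X\<close> on \<open>C\<close> after its ends.
  The three vertices \<open>x\<close>, \<open>u\<close>, \<open>u'\<close> are separated in this sense, so their degrees into \<open>C\<close> sum to at
  least \<open>k + 5\<close>. If the neighbours of \<open>u\<close> and \<open>u'\<close> do not cross on \<open>C\<close>, then these two contribute
  at most \<open>k + 2\<close>, so \<open>x\<close> has at least three neighbours on \<open>C\<close>.

  A crossing reroutes \<open>C\<close> through \<open>R\<close> at the cost of one vertex. If \<open>R\<close> contains two vertices of \<open>X\<close>,
  this is impossible, and the successors of all the neighbours of \<open>x\<close> give a contradiction. Otherwise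
  a crossing yields another extremal cycle missing a vertex that has two neighbours on it. Here
  one counts over all vertices that can be exchanged in this way: they are pairwise separated, none
  of them is adjacent to all but one vertex of \<open>Y\<close> on \<open>C\<close>, and so every missed vertex has at most one
  neighbour on an extremal cycle.
\<close>

section \<open>Paths and cycles in bipartite graphs\<close>

locale bipartite =
  fixes X Y :: "'a set" and E :: "'a \<Rightarrow> 'a \<Rightarrow> bool"
  assumes finite_X: "finite X" and finite_Y: "finite Y" and disjoint: "X \<inter> Y = {}"
    and edge: "E u v \<Longrightarrow> (u \<in> X \<and> v \<in> Y) \<or> (u \<in> Y \<and> v \<in> X)"
    and E_sym: "E u v \<Longrightarrow> E v u"
begin

abbreviation nb :: "'a \<Rightarrow> 'a set" where "nb u \<equiv> {v. E u v}"

definition path :: "'a list \<Rightarrow> bool" where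
  "path p \<longleftrightarrow> distinct p \<and> successively E p"

text \<open>A single edge counts as a cycle through one vertex of \<^term>\<open>X\<close>.\<close>

definition cyc :: "'a list \<Rightarrow> bool" where
  "cyc c \<longleftrightarrow> c \<noteq> [] \<and> distinct c \<and> successively E c \<and> E (last c) (hd c)"

lemma E_commute: "E u v \<longleftrightarrow> E v u"
  using E_sym by blast

lemma not_X_and_Y: "v \<in> X \<Longrightarrow> v \<in> Y \<Longrightarrow> False"
  using disjoint by blast

lemma edge_from_X: "E u v \<Longrightarrow> u \<in> X \<Longrightarrow> v \<in> Y"
  using edge not_X_and_Y by blast

lemma edge_from_Y: "E u v \<Longrightarrow> u \<in> Y \<Longrightarrow> v \<in> X"
  using edge not_X_and_Y by blast

lemma edge_to_X: "E u v \<Longrightarrow> v \<in> X \<Longrightarrow> u \<in> Y"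
  using edge not_X_and_Y by blast

lemma edge_to_Y: "E u v \<Longrightarrow> v \<in> Y \<Longrightarrow> u \<in> X"
  using edge not_X_and_Y by blast

lemma nb_X: "u \<in> X \<Longrightarrow> nb u \<subseteq> Y"
  using edge_from_X by blast

lemma finite_nb: "finite (nb u)"
proof -
  have "nb u \<subseteq> X \<union> Y" using edge by blast
  then show ?thesis using finite_X finite_Y finite_subset by blast
qed

lemma successively_rev_E [simp]: "successively E (rev p) \<longleftrightarrow> successively E p"
proof -
  have "(\<lambda>x y. E y x) = E" using E_commute by blast
  then show ?thesis by (metis successively_rev)
qed

lemma path_rev [simp]: "path (rev p) \<longleftrightarrow> path p"
  unfolding path_def successively_rev_E by simp

lemma path_append:
  "path (p @ q) \<longleftrightarrow> path p \<and> path q \<and> set p \<inter> set q = {} \<and>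
    (p = [] \<or> q = [] \<or> E (last p) (hd q))"
  by (auto simp: path_def successively_append_iff)

lemma path_single [simp]: "path [v]"
  by (simp add: path_def)

lemma cyc_alt: "cyc c \<longleftrightarrow> c \<noteq> [] \<and> path c \<and> E (last c) (hd c)"
  by (auto simp: cyc_def path_def)

lemma cyc_appendI:
  "path p \<Longrightarrow> path q \<Longrightarrow> set p \<inter> set q = {} \<Longrightarrow> p \<noteq> [] \<Longrightarrow> q \<noteq> [] \<Longrightarrow>
    E (last p) (hd q) \<Longrightarrow> E (last q) (hd p) \<Longrightarrow> cyc (p @ q)"
  by (simp add: cyc_alt path_append)

lemma cyc_rotate: "cyc (a @ b) \<Longrightarrow> cyc (b @ a)"
  by (cases "a = []"; cases "b = []") (auto simp: cyc_alt path_append)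

lemma path_vertices:
  assumes "successively E p" "length p \<ge> 2" shows "set p \<subseteq> X \<union> Y"
proof
  fix v assume "v \<in> set p"
  then obtain i where i: "i < length p" "v = p ! i" by (metis in_set_conv_nth)
  have "\<exists>u. E v u"
  proof (cases "Suc i < length p")
    case True
    then show ?thesis using assms(1) i successively_nth by blast
  next
    case False
    then have "Suc (i - 1) < length p" "Suc (i - 1) = i" using i assms(2) by auto
    then have "E (p ! (i - 1)) (p ! i)" using assms(1) successively_nth by metis
    then show ?thesis using i E_sym by blast
  qed
  then show "v \<in> X \<union> Y" using edge by blast
qed

lemma cyc_vertices: "cyc c \<Longrightarrow> set c \<subseteq> X \<union> Y"
proof -
  assume c: "cyc c"
  have "length c \<ge> 2"
  proof (rule ccontr)
    assume "\<not> length c \<ge> 2"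
    moreover have "length c \<noteq> 0" using c by (simp add: cyc_def)
    ultimately have "length c = 1" by linarith
    then obtain v where "c = [v]" by (metis One_nat_def length_0_conv length_Suc_conv)
    then show False using c edge[of v v] disjoint by (auto simp: cyc_def)
  qed
  then show ?thesis using c path_vertices by (simp add: cyc_def)
qed

section \<open>Alternation between \<open>X\<close> and \<open>Y\<close> and counting along paths
  and cycles\<close>

lemma alternating:
  assumes "successively E p" "hd p \<in> X" "i < length p"
  shows "(even i \<longrightarrow> p ! i \<in> X) \<and> (odd i \<longrightarrow> p ! i \<in> Y)"
  using assms(3)
proof (induction i)
  case 0
  then show ?case using assms by (simp add: hd_conv_nth)
next
  case (Suc i)
  then have "E (p ! i) (p ! Suc i)" using assms(1) successively_nth by blast
  then show ?case using Suc edge_from_X edge_from_Y by auto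
qed

lemma alternating_X:
  assumes "successively E p" "hd p \<in> X" "i < length p"
  shows "p ! i \<in> X \<longleftrightarrow> even i" "p ! i \<in> Y \<longleftrightarrow> odd i"
  using alternating[OF assms] not_X_and_Y by blast+

lemma card_odd_below: "card {i. i < n \<and> odd i} = n div 2"
proof (induction n)
  case (Suc n)
  have "{i. i < Suc n \<and> odd i} = (if odd n then insert n {i. i < n \<and> odd i} else {i. i < n \<and> odd i})"
    by (auto simp: less_Suc_eq)
  then show ?case using Suc by auto
qed auto

lemma card_even_below: "card {i. i < n \<and> even i} = (n + 1) div 2"
proof (induction n)
  case (Suc n)
  have "{i. i < Suc n \<and> even i} = (if even n then insert n {i. i < n \<and> even i} else {i. i < n \<and> even i})"
    by (auto simp: less_Suc_eq)
  then show ?case using Suc by auto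
qed auto

lemma card_nth_image:
  assumes "distinct p" "I \<subseteq> {..<length p}" shows "card ((!) p ` I) = card I"
  using assms by (intro card_image inj_onI) (meson lessThan_iff nth_eq_iff_index_eq subsetD)

lemma card_alternating:
  assumes "path p" "hd p \<in> X"
  shows "card (X \<inter> set p) = (length p + 1) div 2" "card (Y \<inter> set p) = length p div 2"
proof -
  note alt = alternating_X[OF _ assms(2)]
  have s: "successively E p" and d: "distinct p" using assms by (auto simp: path_def)
  have "X \<inter> set p = (!) p ` {i. i < length p \<and> even i}"
    using alt(1)[OF s] by (fastforce simp: in_set_conv_nth)
  then show "card (X \<inter> set p) = (length p + 1) div 2"
    using card_nth_image[OF d, of "{i. i < length p \<and> even i}"] card_even_below by auto
  have "Y \<inter> set p = (!) p ` {i. i < length p \<and> odd i}"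
    using alt(2)[OF s] by (fastforce simp: in_set_conv_nth)
  then show "card (Y \<inter> set p) = length p div 2"
    using card_nth_image[OF d, of "{i. i < length p \<and> odd i}"] card_odd_below by auto
qed

lemma cyc_card:
  assumes "cyc c" shows "card (Y \<inter> set c) = card (X \<inter> set c)" "length c = 2 * card (X \<inter> set c)"
proof -
  have *: "card (Y \<inter> set c) = card (X \<inter> set c) \<and> length c = 2 * card (X \<inter> set c)"
    if c: "cyc c" "hd c \<in> X" for c
  proof -
    have p: "path c" "c \<noteq> []" and e: "E (last c) (hd c)" using c by (auto simp: cyc_alt)
    have "c ! (length c - 1) \<in> Y" using e c(2) p(2) edge_to_X by (simp add: last_conv_nth)
    then have "odd (length c - 1)"
      using alternating_X(2)[of c "length c - 1"] p c(2) by (auto simp: path_def)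
    then have "even (length c)" using p(2) by (cases "length c") auto
    then show ?thesis using card_alternating[OF p(1) c(2)] by auto
  qed
  have "card (Y \<inter> set c) = card (X \<inter> set c) \<and> length c = 2 * card (X \<inter> set c)"
  proof (cases "hd c \<in> X")
    case True
    then show ?thesis using * assms by blast
  next
    case False
    obtain y l where l: "c = y # l" using assms by (cases c) (auto simp: cyc_def)
    then have y: "y \<in> Y" using False cyc_vertices[OF assms] by auto
    have "l \<noteq> []" using assms l edge[of y y] disjoint by (auto simp: cyc_def)
    then have "E y (hd l)" using assms l by (cases l) (auto simp: cyc_def)
    then have h: "hd (l @ [y]) \<in> X" using y edge_from_Y \<open>l \<noteq> []\<close> by auto
    have "cyc (l @ [y])" using cyc_rotate[of "[y]" l] assms l by auto
    from *[OF this h] show ?thesis using l by simp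
  qed
  then show "card (Y \<inter> set c) = card (X \<inter> set c)" "length c = 2 * card (X \<inter> set c)" by blast+
qed

text \<open>Both sides are compared after shifting the neighbours of \<^term>\<open>u\<close> one step to the left
  and those of \<^term>\<open>u'\<close> one step to the right: the two images lie among the even positions
  and meet exactly in the crossings.\<close>

lemma card_shifted_neighbours:
  assumes p: "path p" "hd p \<in> X" and u: "u \<in> X" "u' \<in> X"
  shows "card (nb u \<inter> set p) + card (nb u' \<inter> set p) \<le> card (Y \<inter> set p) + 1 +
    card {i. 0 < i \<and> Suc i < length p \<and> E u (p ! Suc i) \<and> E u' (p ! (i - 1))}"
    (is "_ \<le> _ + card ?W")
proof -
  have s: "successively E p" and d: "distinct p" using p by (auto simp: path_def)
  note alt = alternating_X[OF s p(2)]
  define M where "M v = {i. i < length p \<and> E v (p ! i)}" for v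
  have M: "card (nb v \<inter> set p) = card (M v)" for v
  proof -
    have "nb v \<inter> set p = (!) p ` M v" by (auto simp: M_def in_set_conv_nth)
    then show ?thesis using card_nth_image[OF d, of "M v"] by (auto simp: M_def)
  qed
  have odd: "odd i" if "i \<in> M v" "v \<in> X" for i v
    using that alt(2)[of i] edge_from_X by (auto simp: M_def)
  define F where "F = (\<lambda>i. i - 1) ` M u"
  define G where "G = Suc ` M u'"
  \<comment> \<open>Neighbours of \<open>u\<close> occupy odd, hence positive, positions, so the
    truncated subtraction loses nothing.\<close>
  have "inj_on (\<lambda>i. i - 1) (M u)"
  proof (rule inj_onI)
    fix i j assume "i \<in> M u" "j \<in> M u" "i - 1 = j - 1"
    then show "i = j" using odd[of i u] odd[of j u] u by (cases i; cases j) auto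
  qed
  then have F: "card F = card (M u)" unfolding F_def by (rule card_image)
  have G: "card G = card (M u')" unfolding G_def by (rule card_image) simp
  have fin: "finite F" "finite G" by (auto simp: F_def G_def M_def)
  \<comment> \<open>A shift to the right may reach position \<open>length p\<close>, one past the
    end. The even positions up to there outnumber the vertices of \<open>Y\<close> on
    \<open>p\<close> by one, whence the \<open>+ 1\<close>.\<close>
  have FG: "F \<union> G \<subseteq> {i. i < length p + 1 \<and> even i}"
    using odd u by (auto simp: F_def G_def) (auto simp: M_def)
  have "F \<inter> G \<subseteq> ?W"
  proof
    fix i assume i: "i \<in> F \<inter> G"
    obtain j where j: "j \<in> M u" "i = j - 1" using i by (auto simp: F_def)
    obtain l where l: "l \<in> M u'" "i = Suc l" using i by (auto simp: G_def)
    have "j = Suc i" using odd[OF j(1) u(1)] j(2) by (cases j) auto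
    then have "E u (p ! Suc i)" "Suc i < length p" using j(1) by (auto simp: M_def)
    moreover have "0 < i" "E u' (p ! (i - 1))" using l by (auto simp: M_def)
    ultimately show "i \<in> ?W" by simp
  qed
  moreover have "finite ?W" by (rule finite_subset[of _ "{..<length p}"]) auto
  ultimately have W: "card (F \<inter> G) \<le> card ?W" by (rule card_mono[rotated])
  have "card (F \<union> G) \<le> card {i. i < length p + 1 \<and> even i}"
    by (rule card_mono[OF _ FG]) auto
  also have "\<dots> = length p div 2 + 1" using card_even_below[of "length p + 1"] by auto
  finally have "card (F \<union> G) \<le> card (Y \<inter> set p) + 1" using card_alternating[OF p] by simp
  moreover have "card F + card G = card (F \<union> G) + card (F \<inter> G)" using fin by (rule card_Un_Int)
  ultimately show ?thesis using M F G W by simp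
qed

end

section \<open>Bypasses of an extremal cycle\<close>

text \<open>A counterexample, refuted in \<open>no_deficient_graph\<close>: \<open>k\<close> is the
  maximum number of vertices of \<open>X\<close> on a cycle. In the counts it enters through
  \<open>k + 1 \<le> \<delta>\<close>.\<close>

locale deficient = bipartite X Y E for X Y :: "'a set" and E +
  fixes \<delta> k :: nat
  assumes card_X: "card X \<le> \<delta>" and card_Y: "card Y + 5 \<le> 3 * \<delta>"
    and min_degree: "v \<in> X \<Longrightarrow> \<delta> \<le> card (nb v)"
    and two_conn: "two_connected (X \<union> Y) E"
    and k_less: "k < card X" and maximal: "cyc c \<Longrightarrow> card (X \<inter> set c) \<le> k"
    and attained: "\<exists>c. cyc c \<and> card (X \<inter> set c) = k"
begin

section \<open>Extremal cycles and the basic degree count\<close>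

definition mcyc :: "'a list \<Rightarrow> bool" where
  "mcyc c \<longleftrightarrow> cyc c \<and> card (X \<inter> set c) = k"

lemma mcyc_rotate: "mcyc (a @ b) \<Longrightarrow> mcyc (b @ a)"
  using cyc_rotate by (auto simp: mcyc_def Un_commute)

lemma mcyc_card: "mcyc c \<Longrightarrow> card (Y \<inter> set c) = k"
  using cyc_card by (simp add: mcyc_def)

lemma not_larger:
  assumes "mcyc c" "cyc c'" "X \<inter> set c \<subseteq> set c'" "v \<in> X" "v \<in> set c'" "v \<notin> set c"
  shows False
proof -
  have "X \<inter> set c \<subset> X \<inter> set c'" using assms by blast
  then have "card (X \<inter> set c) < card (X \<inter> set c')" using finite_X by (intro psubset_card_mono) auto
  then show False using assms maximal[of c'] by (simp add: mcyc_def)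
qed

text \<open>Off \<open>S\<close> the neighbourhoods of the vertices of \<open>I\<close> are disjoint
  parts of \<open>Y - S\<close>, which has at most \<open>3 * \<delta> - 5 - k\<close> elements; the
  rest of the degrees must fall into \<open>S\<close>.\<close>

lemma degree_sum:
  assumes "I \<subseteq> X" "card (Y \<inter> S) = k"
    and "\<And>u v. u \<in> I \<Longrightarrow> v \<in> I \<Longrightarrow> u \<noteq> v \<Longrightarrow> nb u \<inter> nb v \<subseteq> S"
  shows "card I * \<delta> + k + 5 \<le> (\<Sum>u\<in>I. card (nb u \<inter> S)) + 3 * \<delta>"
proof -
  have fin: "finite I" using assms(1) finite_X finite_subset by blast
  have "(\<Sum>u\<in>I. card (nb u - S)) = card (\<Union>u\<in>I. nb u - S)"
    using fin finite_nb assms(3) by (intro card_UN_disjoint[symmetric]) auto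
  also have "\<dots> \<le> card (Y - S)"
    using nb_X assms(1) finite_Y by (intro card_mono) auto
  also have "\<dots> = card Y - k"
    using card_Diff_subset_Int[of Y S] finite_Y assms(2) by auto
  finally have out: "(\<Sum>u\<in>I. card (nb u - S)) + k \<le> card Y"
    using assms(2) card_mono[of Y "Y \<inter> S"] finite_Y by auto
  have "card I * \<delta> \<le> (\<Sum>u\<in>I. card (nb u))"
    using sum_mono[of I "\<lambda>_. \<delta>" "\<lambda>u. card (nb u)"] assms(1) min_degree by auto
  also have "\<dots> = (\<Sum>u\<in>I. card (nb u \<inter> S) + card (nb u - S))"
    using finite_nb by (intro sum.cong) (auto simp: card_Int_Diff)
  finally show ?thesis using out card_Y by (simp add: sum.distrib)
qed

text \<open>A maximal cycle with a bypass \<^term>\<open>R\<close> joining its vertices \<^term>\<open>last B\<close> and \<^term>\<open>last A\<close>.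
  The next vertices of \<^term>\<open>X\<close> on the cycle are \<^term>\<open>hd A\<close> and \<^term>\<open>hd B\<close>; an end of the bypass
  that lies in \<^term>\<open>X\<close> is followed by the single vertex in \<^term>\<open>e\<close> or \<^term>\<open>d\<close>.\<close>

definition config :: "'a list \<Rightarrow> 'a list \<Rightarrow> 'a list \<Rightarrow> 'a list \<Rightarrow> 'a list \<Rightarrow> bool" where
  "config A d B e R \<longleftrightarrow> mcyc (A @ d @ B @ e) \<and> A \<noteq> [] \<and> B \<noteq> [] \<and> hd A \<in> X \<and> hd B \<in> X \<and>
    set d \<subseteq> Y \<and> length d \<le> 1 \<and> set e \<subseteq> Y \<and> length e \<le> 1 \<and>
    path R \<and> R \<noteq> [] \<and> set R \<inter> set (A @ d @ B @ e) = {} \<and> X \<inter> set R \<noteq> {} \<and>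
    E (last A) (last R) \<and> E (last B) (hd R)"

text \<open>Transfers to \<open>hd B\<close> whatever is proved for \<open>hd A\<close>.\<close>

lemma config_sym: "config A d B e R \<Longrightarrow> config B e A d (rev R)"
  using mcyc_rotate[of "A @ d" "B @ e"] unfolding config_def
  by (auto simp: hd_rev last_rev)

lemma config_paths:
  assumes "config A d B e R"
  shows "path A" "path B" "path R" "set A \<inter> set B = {}" "set R \<inter> set A = {}" "set R \<inter> set B = {}"
    "set d \<inter> set A = {}" "set d \<inter> set B = {}" "set e \<inter> set A = {}" "set e \<inter> set B = {}"
    "set d \<inter> set e = {}" "path (A @ d @ B)" "length d \<le> 1"
    "A \<noteq> []" "B \<noteq> []" "R \<noteq> []" "hd A \<in> X" "hd B \<in> X" "E (last A) (last R)" "E (last B) (hd R)"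
    "path d" "path e" "set R \<inter> set d = {}" "set R \<inter> set e = {}"
    "d \<noteq> [] \<Longrightarrow> E (last A) (hd d) \<and> E (last d) (hd B)" "d = [] \<Longrightarrow> E (last A) (hd B)"
    "e \<noteq> [] \<Longrightarrow> E (last B) (hd e) \<and> E (last e) (hd A)" "e = [] \<Longrightarrow> E (last B) (hd A)"
    "set d \<subseteq> Y" "set e \<subseteq> Y" "mcyc (A @ d @ B @ e)"
    "X \<inter> set d = {}" "X \<inter> set e = {}" "hd A \<noteq> hd B" "X \<inter> set R \<noteq> {}"
proof -
  show m: "mcyc (A @ d @ B @ e)" and ne: "A \<noteq> []" "B \<noteq> []" and "R \<noteq> []" "hd A \<in> X" "hd B \<in> X"
    "set d \<subseteq> Y" "set e \<subseteq> Y" "path R" "E (last A) (last R)" "E (last B) (hd R)" "X \<inter> set R \<noteq> {}"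
    "length d \<le> 1"
    using assms unfolding config_def by simp_all
  show "X \<inter> set d = {}" "X \<inter> set e = {}" using assms disjoint unfolding config_def by blast+
  show "set R \<inter> set A = {}" "set R \<inter> set B = {}" "set R \<inter> set d = {}" "set R \<inter> set e = {}"
    using assms unfolding config_def set_append by blast+
  have p: "path (A @ d @ B @ e)" and l: "E (last (A @ d @ B @ e)) (hd A)"
    using m ne by (auto simp: mcyc_def cyc_alt)
  show "path A" "path B" "path d" "path e" using p unfolding path_append by blast+
  show AB: "set A \<inter> set B = {}" and "set d \<inter> set A = {}" "set d \<inter> set B = {}" "set e \<inter> set A = {}"
    "set e \<inter> set B = {}" "set d \<inter> set e = {}"
    using p unfolding path_append set_append by blast+
  have "path ((A @ d @ B) @ e)" using p by simp
  then show "path (A @ d @ B)" unfolding path_append[of "A @ d @ B"] by blast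
  show "hd A \<noteq> hd B" using AB hd_in_set[OF ne(1)] hd_in_set[OF ne(2)] by auto
  show d: "E (last A) (hd d) \<and> E (last d) (hd B)" if "d \<noteq> []" using that p ne by (simp add: path_append)
  show "E (last A) (hd B)" if "d = []" using that p ne by (simp add: path_append)
  show e: "E (last B) (hd e) \<and> E (last e) (hd A)" if "e \<noteq> []" using that p l ne by (simp add: path_append)
  show "E (last B) (hd A)" if "e = []" using that l ne by simp
qed

section \<open>Enlarging the cycle by a bypass, and the resulting separation of
  neighbourhoods\<close>

lemma not_larger_by_bypass:
  assumes c: "config A d B e R" and "cyc c'" "set A \<union> set B \<subseteq> set c'" "v \<in> X" "v \<in> set R" "v \<in> set c'"
  shows False
proof (rule not_larger)
  note p = config_paths[OF c]
  show "mcyc (A @ d @ B @ e)" by (fact p(31))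
  \<comment> \<open>\<open>d\<close> and \<open>e\<close> contain no vertex of \<open>X\<close>, so
    it suffices to cover \<open>A\<close> and \<open>B\<close>.\<close>
  show "X \<inter> set (A @ d @ B @ e) \<subseteq> set c'" using p(32,33) assms(3) by auto
  show "v \<notin> set (A @ d @ B @ e)" using assms(5) p(5,6,23,24) by auto
qed (use assms in auto)

text \<open>\<open>A\<close>, the reversed bypass and the reversed \<open>B\<close> form a path from
  \<open>hd A\<close> to \<open>hd B\<close> with all vertices of \<open>X\<close> on the cycle and
  on \<open>R\<close>. A vertex off this path that is adjacent to both ends closes it to a cycle
  that is too large; it may lie in \<open>d\<close> or \<open>e\<close>.\<close>

lemma spanning_path_closed:
  assumes c: "config A d B e R" and z: "z \<notin> set A \<union> set B \<union> set R" "E (hd A) z" "E (hd B) z"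
  shows False
proof -
  note p = config_paths[OF c]
  have "cyc ((A @ rev R) @ (rev B @ [z]))"
  proof (rule cyc_appendI)
    show "path (A @ rev R)" unfolding path_append using p(1,3,5,16,19) by (auto simp: hd_rev)
    show "path (rev B @ [z])" unfolding path_append using p(2) z by (auto simp: last_rev)
    show "set (A @ rev R) \<inter> set (rev B @ [z]) = {}" using p(4,6) z(1) by auto
    show "E (last (A @ rev R)) (hd (rev B @ [z]))"
      using p(15,16,20) E_sym by (simp add: hd_rev last_rev)
    show "E (last (rev B @ [z])) (hd (A @ rev R))" using p(14) z(2) E_sym by simp
  qed (use p(14,15) in auto)
  moreover obtain v where v: "v \<in> X" "v \<in> set R" using p(35) by auto
  ultimately show False using not_larger_by_bypass[OF c _ _ v, of "(A @ rev R) @ (rev B @ [z])"] by auto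
qed

text \<open>A predecessor of \<open>z\<close> on \<open>R\<close> would lie in \<open>X\<close>. The
  cycle along \<open>A\<close>, \<open>d\<close>, \<open>B\<close> and \<open>R\<close> as far as
  \<open>z\<close>, then back to \<open>hd A\<close>, would gain it and lose only
  \<open>e\<close>.\<close>

lemma first_neighbour_in_bypass:
  assumes c: "config A d B e R" and z: "z \<in> set R" "E (hd A) z"
  shows "z = hd R"
proof -
  note p = config_paths[OF c]
  obtain r s where R: "R = r @ z # s" using z(1) by (meson split_list)
  have "r = []"
  proof (rule ccontr)
    assume r: "r \<noteq> []"
    have "E (last r) z" using p(3) R r by (auto simp: path_append)
    then have v: "last r \<in> X" using edge_to_Y edge_from_X[OF z(2) p(17)] by blast
    have "cyc ((A @ d @ B) @ (r @ [z]))"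
    proof (rule cyc_appendI[OF p(12)])
      show "path (r @ [z])" using p(3) R by (auto simp: path_append)
      show "set (A @ d @ B) \<inter> set (r @ [z]) = {}" using p(5,6,23) R by auto
      show "E (last (A @ d @ B)) (hd (r @ [z]))" using p(15,20) r R by simp
      show "E (last (r @ [z])) (hd (A @ d @ B))" using p(14) z(2) E_sym by simp
    qed (use p(14) in auto)
    then show False
      by (rule not_larger_by_bypass[OF c _ _ v]) (use last_in_set[OF r] R in auto)
  qed
  then show ?thesis using R by simp
qed

text \<open>By \<open>first_neighbour_in_bypass\<close> and symmetry, excluding these two edges
  excludes every edge from \<open>hd A\<close> or \<open>hd B\<close> to the bypass.\<close>

definition clean_config :: "'a list \<Rightarrow> 'a list \<Rightarrow> 'a list \<Rightarrow> 'a list \<Rightarrow> 'a list \<Rightarrow> bool" where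
  "clean_config A d B e R \<longleftrightarrow> config A d B e R \<and> \<not> E (hd A) (hd R) \<and> \<not> E (hd B) (last R)"

lemma clean_config_sym: "clean_config A d B e R \<Longrightarrow> clean_config B e A d (rev R)"
  using config_sym[of A d B e R] config_paths(16)[of A d B e R]
  by (auto simp: clean_config_def hd_rev last_rev)

lemma clean_not_adjacent:
  assumes "clean_config A d B e R" "z \<in> set R" shows "\<not> E (hd A) z"
  using assms first_neighbour_in_bypass by (auto simp: clean_config_def)

lemma clean_separated:
  assumes c: "clean_config A d B e R"
  shows "nb (hd A) \<inter> nb (hd B) \<subseteq> set (A @ d @ B @ e)"
proof
  fix z assume z: "z \<in> nb (hd A) \<inter> nb (hd B)"
  show "z \<in> set (A @ d @ B @ e)"
    using spanning_path_closed[of A d B e R z] clean_not_adjacent[OF c] z c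
    by (auto simp: clean_config_def)
qed

text \<open>A common neighbour \<open>z\<close> off the cycle is also off \<open>R\<close>, so
  \<open>A\<close>, \<open>d\<close>, \<open>B\<close>, the bypass as far as \<open>x\<close>, and
  \<open>z\<close> would form a cycle that gains \<open>x\<close>.\<close>

lemma clean_separated_bypass:
  assumes c: "clean_config A d B e R" and x: "x \<in> X" "x \<in> set R"
  shows "nb x \<inter> nb (hd A) \<subseteq> set (A @ d @ B @ e)"
proof
  fix z assume z: "z \<in> nb x \<inter> nb (hd A)"
  show "z \<in> set (A @ d @ B @ e)"
  proof (rule ccontr)
    assume n: "z \<notin> set (A @ d @ B @ e)"
    have c': "config A d B e R" using c by (simp add: clean_config_def)
    note p = config_paths[OF c']
    obtain r s where R: "R = r @ x # s" using x(2) by (meson split_list)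
    have "z \<notin> set R" using clean_not_adjacent[OF c] z by auto
    have "path ((r @ [x]) @ s)" using p(3) R by simp
    then have "path (r @ [x])" unfolding path_append by blast
    have "cyc ((A @ d @ B) @ ((r @ [x]) @ [z]))"
    proof (rule cyc_appendI[OF p(12)])
      show "path ((r @ [x]) @ [z])"
        using \<open>path (r @ [x])\<close> \<open>z \<notin> set R\<close> R z unfolding path_append[of "r @ [x]"] by simp
      show "set (A @ d @ B) \<inter> set ((r @ [x]) @ [z]) = {}" using p(5,6,23) R n by auto
      show "E (last (A @ d @ B)) (hd ((r @ [x]) @ [z]))" using p(15,20) R by (cases r) auto
      show "E (last ((r @ [x]) @ [z])) (hd (A @ d @ B))" using p(14) z E_sym by simp
    qed (use p(14) in auto)
    then show False by (rule not_larger_by_bypass[OF c' _ _ x]) auto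
  qed
qed

text \<open>With three separated vertices the terms \<open>3 * \<delta>\<close> in
  \<open>degree_sum\<close> cancel. An upper bound for the two ends thus becomes a lower bound for
  \<open>x\<close>.\<close>

lemma clean_degree_sum:
  assumes c: "clean_config A d B e R" and x: "x \<in> X" "x \<in> set R"
  shows "k + 5 \<le> card (nb x \<inter> set (A @ d @ B @ e)) +
    card (nb (hd A) \<inter> set (A @ d @ B @ e)) + card (nb (hd B) \<inter> set (A @ d @ B @ e))"
proof -
  let ?S = "set (A @ d @ B @ e)"
  have c': "config A d B e R" using c by (simp add: clean_config_def)
  note p = config_paths[OF c']
  have neq: "hd A \<noteq> hd B" "x \<noteq> hd A" "x \<noteq> hd B"
    using p(5,6,14,15,34) hd_in_set[of A] hd_in_set[of B] x(2) by auto
  have sep: "nb (hd A) \<inter> nb (hd B) \<subseteq> ?S" "nb x \<inter> nb (hd A) \<subseteq> ?S" "nb x \<inter> nb (hd B) \<subseteq> ?S"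
    using clean_separated[OF c] clean_separated_bypass[OF c x]
      clean_separated_bypass[OF clean_config_sym[OF c], of x] x by auto
  have "card (Y \<inter> ?S) = k" using p(31) by (rule mcyc_card)
  then have "card {x, hd A, hd B} * \<delta> + k + 5 \<le> (\<Sum>u\<in>{x, hd A, hd B}. card (nb u \<inter> ?S)) + 3 * \<delta>"
    using sep x(1) p(17,18) by (intro degree_sum) auto
  then show ?thesis using neq by simp
qed

text \<open>If \<^term>\<open>hd A\<close> is adjacent to \<^term>\<open>hd R\<close>, then \<^term>\<open>hd R\<close> can replace the vertex in \<^term>\<open>e\<close>
  on the cycle.\<close>

lemma clean_step:
  assumes c: "config A d B e R" and a: "E (hd A) (hd R)"
  shows "config A d (B @ [hd R]) [] (tl R)" "tl R \<noteq> []" "X \<inter> set (tl R) = X \<inter> set R"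
    "last (tl R) = last R" "hd (tl R) \<in> X" "hd R \<in> Y"
proof -
  note p = config_paths[OF c]
  obtain z R' where R: "R = z # R'" using p(16) by (cases R) auto
  have z: "z \<in> Y" using a p R edge_from_X by auto
  have X: "X \<inter> set R' = X \<inter> set R" using R z not_X_and_Y by auto
  have ne: "R' \<noteq> []" using X p(35) by force
  have "path ([z] @ R')" using p(3) R by simp
  then have zR: "E z (hd R')" and pR: "path R'" "z \<notin> set R'"
    using ne unfolding path_append by simp_all
  have "cyc ((A @ d @ B) @ [z])"
  proof (rule cyc_appendI[OF p(12)])
    show "set (A @ d @ B) \<inter> set [z] = {}" using p(5,6,23) R by auto
    show "E (last (A @ d @ B)) (hd [z])" using p(15,20) R by simp
    show "E (last [z]) (hd (A @ d @ B))" using p(14) a R E_sym by simp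
  qed (use p(14) in auto)
  moreover have "X \<inter> set (A @ d @ B @ [z]) = X \<inter> set (A @ d @ B @ e)"
    using z p(33) not_X_and_Y by auto
  ultimately have "mcyc (A @ d @ B @ [z])" using p(31) by (simp only: mcyc_def) simp
  moreover have "X \<inter> set R' \<noteq> {}" using X p(35) by simp
  moreover have "set R' \<inter> set (A @ d @ B @ [z]) = {}" using p(5,6,23) pR(2) R by auto
  ultimately have "config A d (B @ [z]) [] R'"
    using c R ne zR pR(1) unfolding config_def by simp
  then show "config A d (B @ [hd R]) [] (tl R)" using R by simp
  show "tl R \<noteq> []" "last (tl R) = last R" "hd (tl R) \<in> X" "hd R \<in> Y"
    using R ne zR z edge_from_Y by auto
  show "X \<inter> set (tl R) = X \<inter> set R" using X unfolding R by simp
qed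

text \<open>Each end is repaired by at most one \<open>clean_step\<close>: afterwards the bypass
  begins in \<open>X\<close> there and cannot be adjacent to the head in \<open>X\<close>.\<close>

lemma clean_config_exists:
  assumes "config A d B e R"
  obtains A' d' B' e' R' where "clean_config A' d' B' e' R'" "X \<inter> set R' = X \<inter> set R"
proof -
  have "\<exists>B e R'. config A d B e R' \<and> \<not> E (hd A) (hd R') \<and> X \<inter> set R' = X \<inter> set R"
  proof (cases "E (hd A) (hd R)")
    case True
    then show ?thesis
      using clean_step[OF assms] config_paths(17)[OF assms] edge_from_X not_X_and_Y by metis
  qed (use assms in auto)
  then obtain B e R' where c: "config A d B e R'" "\<not> E (hd A) (hd R')" "X \<inter> set R' = X \<inter> set R"
    by blast
  show ?thesis
  proof (cases "E (hd B) (last R')")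
    case True
    have R': "R' \<noteq> []" using config_paths(16)[OF c(1)] .
    have c2: "config B e A d (rev R')" using c(1) by (rule config_sym)
    have "E (hd B) (hd (rev R'))" using True R' by (simp add: hd_rev)
    note st = clean_step[OF c2 this]
    let ?R = "rev (tl (rev R'))"
    have c3: "config (A @ [last R']) [] B e ?R"
      using config_sym[OF st(1)] R' by (simp add: hd_rev)
    \<comment> \<open>Repairing one end leaves the other end of the bypass alone, so the first
      non-adjacency survives.\<close>
    have "hd ?R = hd R'" using st(4) R' by (metis hd_rev last_rev rev_rev_ident)
    moreover have "last ?R \<in> X" using st(5) by (simp add: last_rev)
    moreover have "A \<noteq> []" "hd B \<in> X" using config_paths(14,18)[OF c(1)] .
    ultimately have "clean_config (A @ [last R']) [] B e ?R"
      using c3 c(2) edge_from_X[of "hd B" "last ?R"] not_X_and_Y by (auto simp: clean_config_def)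
    then show ?thesis using that st(3) c(3) by simp
  next
    case False
    then show ?thesis using that c by (auto simp: clean_config_def)
  qed
qed

section \<open>Crossings and the degrees of the two ends\<close>

lemma crossing_cycle:
  assumes c: "config A d B e R" and i: "0 < i" "Suc i < length A"
    and E: "E (hd A) (A ! Suc i)" "E (hd B) (A ! (i - 1))"
  defines "c' \<equiv> take i A @ B @ R @ rev (drop (Suc i) A)"
  shows "cyc c'" "X \<inter> set c' = X \<inter> set (A @ d @ B @ e) - {A ! i} \<union> X \<inter> set R" "A ! i \<in> X"
    "A ! i \<notin> set c'"
proof -
  note p = config_paths[OF c]
  have split: "A = take i A @ A ! i # drop (Suc i) A" using i by (simp add: id_take_nth_drop)
  have pA: "path (take i A)" "path (drop (Suc i) A)" "set (take i A) \<inter> set (drop (Suc i) A) = {}"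
    "A ! i \<notin> set (take i A)" "A ! i \<notin> set (drop (Suc i) A)"
    using p(1) by (subst (asm) split, force simp: path_append path_append[of "[_]", simplified])+
  have ne: "take i A \<noteq> []" "drop (Suc i) A \<noteq> []" using i by auto
  have l: "last (take i A) = A ! (i - 1)" "hd (drop (Suc i) A) = A ! Suc i"
    "last (drop (Suc i) A) = last A" "hd (take i A) = hd A"
    using i ne by (auto simp: last_conv_nth[of "take i A"] last_drop hd_drop_conv_nth hd_conv_nth)
  have sub: "set (take i A) \<subseteq> set A" "set (drop (Suc i) A) \<subseteq> set A"
    by (auto dest: in_set_takeD in_set_dropD)
  \<comment> \<open>From \<open>hd A\<close> to \<open>A ! (i - 1)\<close>, across to
    \<open>hd B\<close>, along \<open>B\<close> and the bypass to \<open>last A\<close>, and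
    backwards to \<open>A ! Suc i\<close>, which is adjacent to \<open>hd A\<close>. Within
    \<open>X\<close> only \<open>A ! i\<close> is lost.\<close>
  have "cyc ((take i A @ B) @ (R @ rev (drop (Suc i) A)))"
  proof (rule cyc_appendI)
    show "path (take i A @ B)"
      unfolding path_append using pA(1) p(2,4) sub l(1) E(2) E_sym by auto
    show "path (R @ rev (drop (Suc i) A))"
      unfolding path_append using pA(2) p(3,5,19) sub l(3) ne E_sym by (auto simp: hd_rev)
    show "set (take i A @ B) \<inter> set (R @ rev (drop (Suc i) A)) = {}"
      using pA(3) p(4,5,6) sub by auto
    show "E (last (take i A @ B)) (hd (R @ rev (drop (Suc i) A)))" using p(15,16,20) by simp
    show "E (last (R @ rev (drop (Suc i) A))) (hd (take i A @ B))"
      using ne l E(1) E_sym by (simp add: last_rev)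
  qed (use p(15,16) in auto)
  then show "cyc c'" by (simp add: c'_def)
  have "E (A ! i) (A ! Suc i)" using p(1) i by (auto simp: path_def successively_nth)
  then show x: "A ! i \<in> X" using E(1) p(17) edge_from_X edge_to_Y by blast
  show n: "A ! i \<notin> set c'"
  proof -
    have "A ! i \<in> set A" using i by simp
    then have "A ! i \<notin> set B" "A ! i \<notin> set R" using p(4,5) by blast+
    then show ?thesis using pA(4,5) by (simp add: c'_def)
  qed
  have "set A = set (take i A) \<union> {A ! i} \<union> set (drop (Suc i) A)" by (subst split) auto
  then have "set c' \<union> {A ! i} = set A \<union> set B \<union> set R" by (auto simp: c'_def)
  then have "set c' = set A \<union> set B \<union> set R - {A ! i}" using n by blast
  moreover have "A ! i \<notin> set R" using p(5) i nth_mem[of i A] by auto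
  ultimately show "X \<inter> set c' = X \<inter> set (A @ d @ B @ e) - {A ! i} \<union> X \<inter> set R"
    using p(32,33) by auto
qed

text \<open>By \<open>card_shifted_neighbours\<close> each of the two arcs exceeds its number of
  vertices of \<open>Y\<close> by at most one. The vertex in \<open>d\<close> is adjacent to
  \<open>hd B\<close> and that in \<open>e\<close> to \<open>hd A\<close>; by
  \<open>spanning_path_closed\<close> neither is adjacent to both, so each counts only once.\<close>

lemma end_degrees_without_crossing:
  assumes c: "config A d B e R"
    and A: "\<And>i. 0 < i \<Longrightarrow> Suc i < length A \<Longrightarrow> E (hd A) (A ! Suc i) \<Longrightarrow> E (hd B) (A ! (i - 1)) \<Longrightarrow> False"
    and B: "\<And>i. 0 < i \<Longrightarrow> Suc i < length B \<Longrightarrow> E (hd B) (B ! Suc i) \<Longrightarrow> E (hd A) (B ! (i - 1)) \<Longrightarrow> False"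
  shows "card (nb (hd A) \<inter> set (A @ d @ B @ e)) + card (nb (hd B) \<inter> set (A @ d @ B @ e)) \<le> k + 2"
proof -
  let ?a = "hd A" and ?b = "hd B"
  note p = config_paths[OF c]
  have len: "length d \<le> 1" "length e \<le> 1" using c by (auto simp: config_def)
  have "card (nb ?a \<inter> set A) + card (nb ?b \<inter> set A) \<le> card (Y \<inter> set A) + 1 + card ({} :: nat set)"
    using card_shifted_neighbours[OF p(1,17,17,18)] A
    by (metis (mono_tags, lifting) empty_Collect_eq)
  then have sA: "card (nb ?a \<inter> set A) + card (nb ?b \<inter> set A) \<le> card (Y \<inter> set A) + 1" by simp
  have "card (nb ?b \<inter> set B) + card (nb ?a \<inter> set B) \<le> card (Y \<inter> set B) + 1 + card ({} :: nat set)"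
    using card_shifted_neighbours[OF p(2,18,18,17)] B
    by (metis (mono_tags, lifting) empty_Collect_eq)
  then have sB: "card (nb ?b \<inter> set B) + card (nb ?a \<inter> set B) \<le> card (Y \<inter> set B) + 1" by simp
  have ad: "nb ?a \<inter> set d = {}"
  proof (rule ccontr)
    assume "nb ?a \<inter> set d \<noteq> {}"
    then obtain y where y: "E ?a y" "y \<in> set d" by auto
    then have "d = [y]" using len by (cases d) auto
    then have "E ?b y" using p(25) E_sym by auto
    moreover have "y \<notin> set A \<union> set B \<union> set R" using y p(7,8,23) by auto
    ultimately show False using spanning_path_closed[OF c] y by blast
  qed
  have be: "nb ?b \<inter> set e = {}"
  proof (rule ccontr)
    assume "nb ?b \<inter> set e \<noteq> {}"
    then obtain y where y: "E ?b y" "y \<in> set e" by auto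
    then have "e = [y]" using len by (cases e) auto
    then have "E ?a y" using p(27) E_sym by auto
    moreover have "y \<notin> set A \<union> set B \<union> set R" using y p(9,10,24) by auto
    ultimately show False using spanning_path_closed[OF c] y by blast
  qed
  have ce: "card (nb ?a \<inter> set e) \<le> card (set e)" "card (nb ?b \<inter> set d) \<le> card (set d)"
    by (auto intro: card_mono)
  have "nb ?a \<inter> set (A @ d @ B @ e) = nb ?a \<inter> set A \<union> nb ?a \<inter> set B \<union> nb ?a \<inter> set e"
    using ad by auto
  then have a: "card (nb ?a \<inter> set (A @ d @ B @ e)) \<le>
      card (nb ?a \<inter> set A) + card (nb ?a \<inter> set B) + card (nb ?a \<inter> set e)"
    by (metis (no_types, lifting) card_Un_le add_le_mono1 order_trans)
  have "nb ?b \<inter> set (A @ d @ B @ e) = nb ?b \<inter> set A \<union> nb ?b \<inter> set B \<union> nb ?b \<inter> set d"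
    using be by auto
  then have b: "card (nb ?b \<inter> set (A @ d @ B @ e)) \<le>
      card (nb ?b \<inter> set A) + card (nb ?b \<inter> set B) + card (nb ?b \<inter> set d)"
    by (metis (no_types, lifting) card_Un_le add_le_mono1 order_trans)
  have "k = card (Y \<inter> set (A @ d @ B @ e))" using mcyc_card[OF p(31)] by (rule sym)
  also have "Y \<inter> set (A @ d @ B @ e) = (Y \<inter> set A) \<union> (set d \<union> ((Y \<inter> set B) \<union> set e))"
    using p(29,30) by auto
  also have "card \<dots> = card (Y \<inter> set A) + card (set d \<union> ((Y \<inter> set B) \<union> set e))"
    using p(4,7,9) by (intro card_Un_disjoint) auto
  also have "card (set d \<union> ((Y \<inter> set B) \<union> set e)) = card (set d) + card ((Y \<inter> set B) \<union> set e)"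
    using p(8,11) by (intro card_Un_disjoint) auto
  also have "card ((Y \<inter> set B) \<union> set e) = card (Y \<inter> set B) + card (set e)"
    using p(10) by (intro card_Un_disjoint) auto
  finally show ?thesis using sA sB ce a b by linarith
qed

text \<open>A crossing loses one vertex of \<open>X\<close> and gains at least two from the bypass,
  against maximality.\<close>

lemma end_degrees_two:
  assumes c: "config A d B e R" and R: "2 \<le> card (X \<inter> set R)"
  shows "card (nb (hd A) \<inter> set (A @ d @ B @ e)) + card (nb (hd B) \<inter> set (A @ d @ B @ e)) \<le> k + 2"
proof (rule end_degrees_without_crossing[OF c])
  have no: False if c: "config A d B e R" and R: "2 \<le> card (X \<inter> set R)"
    and i: "0 < i" "Suc i < length A" "E (hd A) (A ! Suc i)" "E (hd B) (A ! (i - 1))" for A d B e R i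
  proof -
    let ?S = "X \<inter> set (A @ d @ B @ e)"
    note cr = crossing_cycle[OF c i]
    have "card (?S - {A ! i} \<union> X \<inter> set R) = card (?S - {A ! i}) + card (X \<inter> set R)"
      using c by (intro card_Un_disjoint) (auto simp: config_def)
    moreover have "card (?S - {A ! i}) = k - 1"
      using cr(3) i c by (subst card_Diff_singleton) (auto simp: config_def mcyc_def)
    ultimately show False using maximal[OF cr(1)] cr(2) R by simp
  qed
  show False if "0 < i" "Suc i < length A" "E (hd A) (A ! Suc i)" "E (hd B) (A ! (i - 1))" for i
    using no[OF c R that] .
  show False if "0 < i" "Suc i < length B" "E (hd B) (B ! Suc i)" "E (hd A) (B ! (i - 1))" for i
    using no[OF config_sym[OF c] _ that] R by simp
qed


section \<open>Configurations from an extremal cycle and an outside path\<close>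

lemma config_exists:
  assumes c: "mcyc c" and t: "t \<in> set c" "t' \<in> set c" "t \<noteq> t'"
    and R: "path R" "R \<noteq> []" "set R \<inter> set c = {}" "X \<inter> set R \<noteq> {}" "E t (hd R)" "E t' (last R)"
  obtains A d B e where "config A d B e R" "set (A @ d @ B @ e) = set c"
proof -
  obtain x where x: "x \<in> X" "x \<in> set R" using R(4) by auto
  \<comment> \<open>The cycle is cut behind \<open>t\<close>. If \<open>t\<close> lies in
    \<open>X\<close>, the following vertex of \<open>Y\<close> is set aside as \<open>e\<close>, so
    that \<open>W\<close> starts in \<open>X\<close> in either case.\<close>
  obtain W e where W: "mcyc (W @ e)" "set (W @ e) = set c" "W \<noteq> []" "last W = t" "hd W \<in> X"
    "set e \<subseteq> Y" "length e \<le> 1"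
  proof -
    obtain l r where lr: "c = l @ t # r" using t(1) by (meson split_list)
    have m: "mcyc (r @ l @ [t])" using mcyc_rotate[of "l @ [t]" r] c lr by simp
    have s: "set (r @ l @ [t]) = set c" using lr by auto
    have h: "E t (hd (r @ l @ [t]))" using m by (simp add: mcyc_def cyc_alt)
    show ?thesis
    proof (cases "t \<in> Y")
      case True
      then show ?thesis using that[of "r @ l @ [t]" "[]"] m s h edge_from_Y by simp
    next
      case False
      then have tX: "t \<in> X" using h edge by blast
      obtain y W where yW: "r @ l @ [t] = y # W" by (cases "r @ l @ [t]") auto
      have y: "y \<in> Y" "t \<noteq> y" using h yW tX edge_from_X not_X_and_Y by auto
      have ne: "W \<noteq> []" using yW y by (metis last.simps last_snoc append_assoc)
      have l: "last W = t" using yW ne by (metis last.simps last_snoc append_assoc)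
      have "mcyc (W @ [y])" using mcyc_rotate[of "[y]" W] m yW by simp
      moreover have "E y (hd W)" using m yW ne by (cases W) (auto simp: mcyc_def cyc_def)
      moreover have "set (W @ [y]) = set c" using s yW by (metis set_append Un_commute append_Cons append_Nil)
      ultimately show ?thesis using that[of W "[y]"] ne l y edge_from_Y by simp
    qed
  qed
  have pW: "path (W @ e)" and cl: "E (last (W @ e)) (hd (W @ e))" using W(1) by (auto simp: mcyc_def cyc_alt)
  have notlarger: False if "cyc c'" "set W \<subseteq> set c'" "set R \<subseteq> set c'" for c'
  proof (rule not_larger[OF W(1) that(1) _ x(1)])
    show "X \<inter> set (W @ e) \<subseteq> set c'" using that(2) W(6) not_X_and_Y by auto
    show "x \<in> set c'" "x \<notin> set (W @ e)" using x(2) that(3) R(3) W(2) by auto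
  qed
  have "t' \<in> set W"
  proof (rule ccontr)
    assume "t' \<notin> set W"
    moreover have "t' \<in> set (W @ e)" using t(2) W(2) by blast
    ultimately have e: "e = [t']" using W(7) by (cases e) auto
    \<comment> \<open>Here \<open>t\<close> and \<open>t'\<close> are consecutive on the cycle, and
      \<open>R\<close> can be inserted between them.\<close>
    have "cyc (W @ (R @ [t']))"
    proof (rule cyc_appendI)
      show "path W" using pW by (simp add: path_append)
      show "path (R @ [t'])" using R E_sym t(2) by (auto simp: path_append)
      show "set W \<inter> set (R @ [t']) = {}" using R(3) W(2) \<open>t' \<notin> set W\<close> by auto
      show "E (last W) (hd (R @ [t']))" using R W(4) by simp
      show "E (last (R @ [t'])) (hd W)" using cl e W(3) by simp
    qed (use W in auto)
    then show False by (rule notlarger) auto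
  qed
  then obtain l r where lr: "W = l @ t' # r" by (meson split_list)
  have r: "r \<noteq> []" "last r = t" using lr W(4) t(3) by (auto split: if_splits)
  have pw: "path ((l @ [t']) @ r @ e)" using pW lr by simp
  then have pl: "path (l @ [t'])" "path (r @ e)" "E t' (hd r)"
    unfolding path_append[of "l @ [t']"] using r by auto
  have hl: "hd (l @ [t']) = hd W" using lr by (cases l) auto
  show ?thesis
  proof (cases "t' \<in> Y")
    case True
    have "config (l @ [t']) [] r e R"
      using W lr r R hl pl True edge_from_Y by (auto simp: config_def)
    then show ?thesis using that W(2) lr by simp
  next
    case False
    then have t': "t' \<in> X" using pl(3) edge by blast
    obtain y B where yB: "r = y # B" using r by (cases r) auto
    have y: "y \<in> Y" using pl(3) t' yB edge_from_X by auto
    show ?thesis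
    proof (cases "B = []")
      case True
      \<comment> \<open>Now \<open>r\<close> consists of \<open>t\<close> alone, directly after
        \<open>t'\<close>; again the bypass fits between them.\<close>
      have "cyc ((l @ [t']) @ (rev R @ (r @ e)))"
      proof (rule cyc_appendI)
        show "path (rev R @ (r @ e))"
          unfolding path_append[of "rev R"] using R pl(2) r True yB E_sym lr W(2) by (auto simp: last_rev)
        show "set (l @ [t']) \<inter> set (rev R @ r @ e) = {}"
          using pw R(3) lr W(2) unfolding path_append[of "l @ [t']"] by auto
        show "E (last (l @ [t'])) (hd (rev R @ r @ e))" using R by (simp add: hd_rev)
        show "E (last (rev R @ r @ e)) (hd (l @ [t']))" proof -
          have "hd (W @ e) = hd W" using W(3) by simp
          then show ?thesis using cl hl r by (simp add: lr)
        qed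
      qed (use pl R in auto)
      then show ?thesis using notlarger[of "(l @ [t']) @ (rev R @ (r @ e))"] lr by auto
    next
      case False
      have "E y (hd B)" using pl(2) yB False path_append[of "[y]" "B @ e"] by simp
      then have "hd B \<in> X" using y edge_from_Y by blast
      then have "config (l @ [t']) [y] B e R"
        using W lr r R hl pl yB False y by (auto simp: config_def)
      then show ?thesis by (rule that) (use W(2) lr yB in auto)
    qed
  qed
qed

section \<open>Successors of the neighbours of a missed vertex\<close>

lemma cyc_next:
  assumes "cyc c" "i < length c" shows "E (c ! i) (c ! (Suc i mod length c))"
proof (cases "Suc i < length c")
  case True
  then show ?thesis using assms by (auto simp: cyc_def successively_nth)
next
  case False
  then have "Suc i = length c" using assms by simp
  then have i: "i = length c - 1" "Suc i mod length c = 0" by simp_all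
  have "c \<noteq> []" "E (last c) (hd c)" using assms(1) by (simp_all add: cyc_def)
  then show ?thesis using i by (metis hd_conv_nth last_conv_nth)
qed

text \<open>The single vertex \<open>v\<close> is a bypass between any two of its neighbours. These
  lie in \<open>Y\<close>, so \<open>d\<close> and \<open>e\<close> are empty, and the configuration
  is clean because \<open>v\<close> and both heads lie in \<open>X\<close>.\<close>

lemma successors_config:
  assumes c: "mcyc c" and v: "v \<in> X" "v \<notin> set c"
    and i: "i < length c" "E v (c ! i)" and j: "j < length c" "E v (c ! j)" and ij: "i \<noteq> j"
  shows "\<exists>A B. clean_config A [] B [] [v] \<and> set (A @ B) = set c \<and>
    hd A = c ! (Suc i mod length c) \<and> hd B = c ! (Suc j mod length c)"
proof -
  let ?n = "length c"
  have *: "\<exists>A B. clean_config A [] B [] [v] \<and> set (A @ B) = set c \<and>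
      hd A = c ! (Suc i mod ?n) \<and> hd B = c ! (Suc j mod ?n)"
    if i: "E v (c ! i)" and j: "j < ?n" "E v (c ! j)" and ij: "i < j" for i j
  proof -
    define A where "A = drop (Suc i) (take (Suc j) c)"
    define B where "B = drop (Suc j) c @ take (Suc i) c"
    have cyc: "cyc c" using c by (simp add: mcyc_def)
    have next_X: "c ! (Suc l mod ?n) \<in> X" if "l < ?n" "E v (c ! l)" for l
      using cyc_next[OF cyc that(1)] edge_from_X[OF that(2) v(1)] edge_from_Y by blast
    have "c = take (Suc i) c @ A @ drop (Suc j) c"
      using ij by (simp add: A_def) (metis Suc_leI append.assoc append_take_drop_id le_SucI min.absorb1 take_take)
    then have m: "mcyc (A @ B)" and s: "set (A @ B) = set c"
      using mcyc_rotate[of "take (Suc i) c" "A @ drop (Suc j) c"] c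
      by (simp_all add: B_def) (metis set_append Un_assoc Un_commute)
    have ne: "A \<noteq> []" "B \<noteq> []" "c \<noteq> []" using ij j by (auto simp: A_def B_def)
    have hA: "hd A = c ! (Suc i mod ?n)"
      using ij j by (simp add: A_def hd_drop_conv_nth)
    have hB: "hd B = c ! (Suc j mod ?n)"
    proof (cases "Suc j < ?n")
      case True
      then show ?thesis by (simp add: B_def hd_append hd_drop_conv_nth)
    next
      case False
      then have "Suc j = ?n" using j by simp
      then show ?thesis using ne by (simp add: B_def hd_conv_nth)
    qed
    have lA: "last A = c ! j" using ij j by (simp add: A_def last_drop last_conv_nth)
    have "last B = last (take (Suc i) c)" using ne by (simp add: B_def)
    then have lB: "last B = c ! i" using ij j ne by (simp add: last_conv_nth)
    have X: "hd A \<in> X" "hd B \<in> X" using next_X[of i] next_X[of j] i j ij hA hB by auto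
    have "config A [] B [] [v]"
      using m ne X v i j s lA lB E_sym by (auto simp: config_def)
    moreover have "\<not> E (hd A) v" "\<not> E (hd B) v" using X v edge_from_X not_X_and_Y by blast+
    ultimately have "clean_config A [] B [] [v]" by (simp add: clean_config_def)
    then show ?thesis using s hA hB by blast
  qed
  show ?thesis
  proof (cases "i < j")
    case True
    then show ?thesis using * i j by blast
  next
    case False
    then obtain A B where "clean_config A [] B [] [v]" "set (A @ B) = set c"
      "hd A = c ! (Suc j mod ?n)" "hd B = c ! (Suc i mod ?n)"
      using *[of j i] i j ij by auto
    then show ?thesis using clean_config_sym[of A "[]" B "[]" "[v]"] by (auto simp: Un_commute)
  qed
qed

lemma next_inj: "cyc c \<Longrightarrow> inj_on (\<lambda>i. c ! (Suc i mod length c)) {..<length c}"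
proof (rule inj_onI)
  fix i j assume c: "cyc c" and ij: "i \<in> {..<length c}" "j \<in> {..<length c}"
    "c ! (Suc i mod length c) = c ! (Suc j mod length c)"
  have "Suc i mod length c = Suc j mod length c"
    using c ij by (metis cyc_def gr_implies_not0 lessThan_iff mod_less_divisor nth_eq_iff_index_eq not_gr_zero)
  then show "i = j" using ij by (auto simp: mod_Suc split: if_splits)
qed

lemma degree_X_le: "mcyc c \<Longrightarrow> u \<in> X \<Longrightarrow> card (nb u \<inter> set c) \<le> k"
  using mcyc_card[of c] nb_X[of u] finite_Y by (metis Int_mono card_mono finite_Int order_refl)

section \<open>Bypasses contain one vertex of X\<close>

text \<open>Counting against all neighbours of the first vertex of \<^term>\<open>X\<close> on the bypass leaves less than
  two neighbours on the cycle for \<^term>\<open>hd B\<close>.\<close>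

lemma no_double_bypass:
  assumes "config A d B e R" "2 \<le> card (X \<inter> set R)"
  shows False
proof -
  obtain A d B e R where cc: "clean_config A d B e R" and R2: "2 \<le> card (X \<inter> set R)"
    using clean_config_exists[OF assms(1)] assms(2) by metis
  have c: "config A d B e R" using cc by (simp add: clean_config_def)
  note p = config_paths[OF c]
  \<comment> \<open>\<open>x\<close> is the first vertex of \<open>X\<close> on the bypass, so
    \<open>x # s\<close> keeps all of its vertices of \<open>X\<close>.\<close>
  obtain r x s where R: "R = r @ x # s" and x: "x \<in> X" and r: "\<forall>y\<in>set r. y \<notin> X"
    using split_list_first_prop[of R "\<lambda>x. x \<in> X"] p(35) by blast
  have xR: "x \<in> set R" using R by simp
  have R2': "2 \<le> card (X \<inter> set (x # s))"
  proof -
    have "X \<inter> set R = X \<inter> set (x # s)" using R r by auto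
    then show ?thesis using R2 by simp
  qed
  define W where "W = B @ e @ A"
  define c where "c = W @ d"
  have m: "mcyc c" using mcyc_rotate[of "A @ d" "B @ e"] p(31) by (simp add: c_def W_def)
  have S: "set (A @ d @ B @ e) = set c" by (auto simp: c_def W_def)
  have cyc: "cyc c" using m by (simp add: mcyc_def)
  have hW: "hd W = hd B" "hd c = hd B" "last W = last A" "W \<noteq> []" using p(14,15) by (simp_all add: W_def c_def)
  have xc: "x \<notin> set c" using xR p(5,6,23,24) by (auto simp: c_def W_def)
  have pxs: "path (x # s)" using p(3) R by (simp add: path_append)
  have ls: "last (x # s) = last R" using R by simp
  let ?deg = "\<lambda>u. card (nb u \<inter> set c)"
  \<comment> \<open>Each neighbour \<open>W ! i\<close> of \<open>x\<close> before the end of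
    \<open>W\<close> gives a new configuration with bypass \<open>x # s\<close>. Its two heads are
    \<open>W ! Suc i\<close> and the fixed vertex \<open>hd B\<close>.\<close>
  define J where "J = {i. Suc i < length W \<and> E x (W ! i)}"
  have J: "i < length c" "E x (c ! i)" "Suc i mod length c = Suc i" "c ! Suc i = W ! Suc i" if "i \<in> J" for i
    using that by (auto simp: J_def c_def nth_append)
  have conf: "clean_config (drop (Suc i) W) d (take (Suc i) W) [] (x # s) \<and>
    set (drop (Suc i) W @ d @ take (Suc i) W) = set c \<and> hd (drop (Suc i) W) = W ! Suc i \<and>
    hd (take (Suc i) W) = hd B" if i: "i \<in> J" for i
  proof -
    have i': "Suc i < length W" "E x (W ! i)" using i by (auto simp: J_def)
    have W: "W = take (Suc i) W @ drop (Suc i) W" by simp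
    have "mcyc (drop (Suc i) W @ d @ take (Suc i) W)"
      using mcyc_rotate[of "take (Suc i) W" "drop (Suc i) W @ d"] m W unfolding c_def
      by (metis append_assoc)
    moreover have s: "set (drop (Suc i) W @ d @ take (Suc i) W) = set c"
      unfolding c_def by (metis W set_append Un_assoc Un_commute)
    moreover have h: "hd (drop (Suc i) W) = W ! Suc i" "hd (take (Suc i) W) = hd B"
      using i' hW by (simp_all add: hd_drop_conv_nth)
    moreover have "W ! Suc i \<in> X"
      using cyc_next[OF cyc J(1)[OF i]] J[OF i] edge_from_X[OF J(2)[OF i] x] edge_from_Y by auto
    moreover have "last (drop (Suc i) W) = last A" using i' hW by (simp add: last_drop)
    moreover have "last (take (Suc i) W) = W ! i" using i' hW by (simp add: last_conv_nth)
    moreover have "set (x # s) \<inter> set c = {}" using R p(5,6,23,24) by (auto simp: c_def W_def)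
    moreover have "length d \<le> 1" by (fact p(13))
    ultimately have "config (drop (Suc i) W) d (take (Suc i) W) [] (x # s)"
      unfolding config_def using i' hW p(18,19,29) pxs ls x E_sym by auto
    moreover have "\<not> E (W ! Suc i) x" using \<open>W ! Suc i \<in> X\<close> x edge_from_X not_X_and_Y by blast
    moreover have "\<not> E (hd B) (last R)" using cc by (simp add: clean_config_def)
    ultimately show ?thesis using s h ls by (simp add: clean_config_def)
  qed
  have finJ: "finite J" by (rule finite_subset[of _ "{..<length W}"]) (auto simp: J_def)
  define u where "u i = W ! Suc i" for i
  have u: "u i = c ! (Suc i mod length c)" if "i \<in> J" for i using J[OF that] by (simp add: u_def)
  have dist: "distinct c" using cyc by (simp add: cyc_def)
  have inj: "inj_on u J"
    using next_inj[OF cyc] J(1) u by (metis (no_types, lifting) inj_on_def lessThan_iff)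
  have uc: "u i \<in> set c" "u i \<noteq> hd B" "u i \<in> X" if "i \<in> J" for i
  proof -
    have "set (drop (Suc i) W) \<inter> set (take (Suc i) W) = {}"
      using conf[OF that] config_paths(4) by (metis clean_config_def)
    moreover have "drop (Suc i) W \<noteq> []" "take (Suc i) W \<noteq> []" using that hW by (auto simp: J_def)
    ultimately show "u i \<noteq> hd B" using conf[OF that] hd_in_set u_def by (metis disjoint_iff)
    show "u i \<in> set c" using that by (auto simp: J_def u_def c_def)
    show "u i \<in> X" using conf[OF that] config_paths(17) by (metis clean_config_def u_def)
  qed
  have dx3: "3 \<le> ?deg x"
    using clean_degree_sum[OF cc x xR] end_degrees_two[OF c R2] unfolding S by linarith
  have dx: "?deg x \<le> card J + 1"
  proof -
    have "nb x \<inter> set c \<subseteq> insert (last A) ((!) W ` J)"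
    proof
      fix t assume t: "t \<in> nb x \<inter> set c"
      have "t \<notin> set d"
      proof
        assume td: "t \<in> set d"
        then have d: "d = [t]" using p(13) by (cases d) auto
        \<comment> \<open>If \<open>x\<close> were adjacent to the vertex in \<open>d\<close>, the
          reversed bypass would fit between \<open>last A\<close> and that vertex.\<close>
        have "cyc (W @ (rev (x # s) @ [t]))"
        proof (rule cyc_appendI)
          show "path W" using cyc by (simp add: cyc_alt path_append c_def)
          have "path (rev (x # s))" using pxs by (simp only: path_rev)
          moreover have "t \<notin> set (x # s)" using R p(23) td by auto
          moreover have "E (last (rev (x # s))) t" using t by simp
          ultimately show "path (rev (x # s) @ [t])" unfolding path_append by simp
          show "set W \<inter> set (rev (x # s) @ [t]) = {}"
            using dist d R p(5,6,24) by (auto simp: c_def W_def)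
          show "E (last W) (hd (rev (x # s) @ [t]))" using hW p(19) R by (cases "s = []") (simp_all add: hd_append hd_rev)
          show "E (last (rev (x # s) @ [t])) (hd W)" using cyc d hW by (simp add: cyc_def c_def)
        qed (use hW in auto)
        then show False by (rule not_larger_by_bypass[OF \<open>config A d B e R\<close> _ _ x xR]) (auto simp: W_def)
      qed
      then have "t \<in> set W" using t by (auto simp: c_def)
      then obtain i where i: "i < length W" "t = W ! i" by (metis in_set_conv_nth)
      show "t \<in> insert (last A) ((!) W ` J)"
      proof (cases "Suc i < length W")
        case True
        then show ?thesis using i t by (auto simp: J_def)
      next
        case False
        then have "i = length W - 1" using i by simp
        then show ?thesis using i hW by (metis insertI1 last_conv_nth)
      qed
    qed
    then have "?deg x \<le> card (insert (last A) ((!) W ` J))" using finJ by (intro card_mono) auto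
    also have "\<dots> \<le> Suc (card ((!) W ` J))" by (rule card_insert_le_m1) auto
    also have "\<dots> \<le> Suc (card J)" using card_image_le[OF finJ] by simp
    finally show ?thesis by simp
  qed
  have dB: "2 \<le> ?deg (hd B)"
  proof -
    have "{hd A, hd B} \<subseteq> X \<inter> set (A @ d @ B @ e)" using p(14,15,17,18) by auto
    then have "card {hd A, hd B} \<le> card (X \<inter> set (A @ d @ B @ e))" using finite_X by (intro card_mono) auto
    then have "2 \<le> k" using p(31,34) by (simp add: mcyc_def)
    then have len: "length c \<ge> 4" using cyc_card(2)[OF cyc] m by (simp add: mcyc_def)
    then have ne: "c \<noteq> []" by auto
    have "E (c ! 0) (c ! 1)" using cyc_next[OF cyc, of 0] len ne by simp
    then have 1: "E (hd B) (c ! 1)" using hW ne by (simp add: hd_conv_nth)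
    have 2: "E (hd B) (last c)" using cyc hW E_sym by (auto simp: cyc_def)
    have "c ! 1 \<noteq> c ! (length c - 1)" using dist len by (subst nth_eq_iff_index_eq) auto
    then have "c ! 1 \<noteq> last c" using ne by (simp add: last_conv_nth)
    then have "card {c ! 1, last c} = 2" by simp
    moreover have "{c ! 1, last c} \<subseteq> nb (hd B) \<inter> set c" using 1 2 len ne by auto
    ultimately show ?thesis using finite_nb card_mono[of "nb (hd B) \<inter> set c"] by (metis finite_Int)
  qed
  have sum: "?deg (u i) + ?deg (hd B) \<le> k + 2" if "i \<in> J" for i
    using end_degrees_two[of "drop (Suc i) W" d "take (Suc i) W" "[]" "x # s"] conf[OF that] R2'
    by (simp add: clean_config_def u_def)
  \<comment> \<open>The separated set consists of \<open>x\<close>, \<open>hd B\<close> and the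
    successors of all neighbours counted by \<open>J\<close>.\<close>
  let ?I = "insert x (insert (hd B) (u ` J))"
  have Bc: "hd B \<in> set c" using p(15) by (auto simp: c_def W_def)
  have notin: "x \<notin> insert (hd B) (u ` J)" "hd B \<notin> u ` J" using xc uc Bc by force+
  have card_I: "card ?I = card J + 2" using notin finJ card_image[OF inj] by simp
  have sep: "nb (u i) \<inter> nb (hd B) \<subseteq> set c" "nb x \<inter> nb (u i) \<subseteq> set c" if "i \<in> J" for i
    using clean_separated[of "drop (Suc i) W" d "take (Suc i) W" "[]" "x # s"]
      clean_separated_bypass[of "drop (Suc i) W" d "take (Suc i) W" "[]" "x # s" x] conf[OF that] x
    by (simp_all add: u_def)
  have sep2: "nb (u i) \<inter> nb (u j) \<subseteq> set c" if ij: "i \<in> J" "j \<in> J" "i \<noteq> j" for i j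
    using successors_config[OF m x xc J(1,2)[OF ij(1)] J(1,2)[OF ij(2)] ij(3)] clean_separated u ij
    by (metis append_Nil append_Nil2)
  have sep3: "nb x \<inter> nb (hd B) \<subseteq> set c"
    using clean_separated_bypass[OF clean_config_sym[OF cc] x] xR S by auto
  have "card ?I * \<delta> + k + 5 \<le> (\<Sum>u\<in>?I. ?deg u) + 3 * \<delta>"
  proof (rule degree_sum)
    show "?I \<subseteq> X" using x p(18) uc by auto
    show "card (Y \<inter> set c) = k" using m by (rule mcyc_card)
    fix v w assume "v \<in> ?I" "w \<in> ?I" "v \<noteq> w"
    then show "nb v \<inter> nb w \<subseteq> set c" using sep sep2 sep3 by auto blast+
  qed
  also have "(\<Sum>u\<in>?I. ?deg u) = ?deg x + (?deg (hd B) + (\<Sum>i\<in>J. ?deg (u i)))"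
    using notin finJ inj by (simp add: sum.reindex)
  finally have main: "(card J + 2) * \<delta> + k + 5 \<le> ?deg x + (?deg (hd B) + (\<Sum>i\<in>J. ?deg (u i))) + 3 * \<delta>"
    unfolding card_I .
  have "(\<Sum>i\<in>J. ?deg (u i) + ?deg (hd B)) \<le> (\<Sum>i\<in>J. k + 2)" using sum by (rule sum_mono)
  then have S1: "(\<Sum>i\<in>J. ?deg (u i)) + card J * ?deg (hd B) \<le> card J * (k + 2)" by (simp add: sum.distrib)
  obtain b where b: "card J = Suc b" "1 \<le> b" using dx dx3 by (cases "card J") auto
  \<comment> \<open>With \<open>card J = b + 1\<close> and \<open>?deg x \<le> b + 2\<close>, the
    estimates \<open>main\<close> and \<open>S1\<close> combine to
    \<open>b * \<delta> + b * ?deg (hd B) + 1 \<le> b * (k + 1) + b * 2\<close>, against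
    \<open>k + 1 \<le> \<delta>\<close> and \<open>2 \<le> ?deg (hd B)\<close>.\<close>
  have "b * (k + 1) \<le> b * \<delta>" using k_less card_X by (intro mult_le_mono2) simp
  then have "b * k + b \<le> b * \<delta>" by simp
  moreover have "b * 2 \<le> b * ?deg (hd B)" using dB by (rule mult_le_mono2)
  moreover have "b * \<delta> + k + 5 \<le> ?deg x + (?deg (hd B) + (\<Sum>i\<in>J. ?deg (u i)))"
    using main b by (simp add: algebra_simps)
  moreover have "(\<Sum>i\<in>J. ?deg (u i)) + b * ?deg (hd B) + ?deg (hd B) \<le> b * k + b * 2 + k + 2"
    using S1 b by (simp add: algebra_simps)
  ultimately show False using dx b by linarith
qed

section \<open>Paths to the cycle, and a first bound on the degree of a missed vertex\<close>

lemma reach: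
  assumes conn: "connected_on U E" and s: "s \<in> U" "s \<notin> S" and t: "t \<in> U" "t \<in> S"
  obtains p t' where "p \<noteq> []" "hd p = s" "path p" "set p \<inter> S = {}" "set p \<subseteq> U" "t' \<in> S" "t' \<in> U" "E (last p) t'"
proof -
  let ?P = "\<lambda>s p t'. p \<noteq> [] \<and> hd p = s \<and> path p \<and> set p \<inter> S = {} \<and> set p \<subseteq> U \<and> t' \<in> S \<and> t' \<in> U \<and> E (last p) t'"
  have "(\<lambda>a b. E a b \<and> a \<in> U \<and> b \<in> U)\<^sup>*\<^sup>* s t" using conn s t by (auto simp: connected_on_def)
  then have "s \<notin> S \<longrightarrow> (\<exists>p t'. ?P s p t')"
  proof (induction rule: converse_rtranclp_induct)
    case base
    then show ?case using t by simp
  next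
    case (step a b)
    show ?case
    proof
      assume a: "a \<notin> S"
      show "\<exists>p t'. ?P a p t'"
      proof (cases "b \<in> S")
        case True
        then have "?P a [a] b" using step a by auto
        then show ?thesis by blast
      next
        case False
        then obtain p t' where p: "?P b p t'" using step by blast
        show ?thesis
        \<comment> \<open>If the walk returns to \<open>a\<close>, the path is shortened to start
          there.\<close>
        proof (cases "a \<in> set p")
          case True
          then obtain l r where "p = l @ a # r" by (meson split_list)
          then have "?P a (a # r) t'" using p by (auto simp: path_append)
          then show ?thesis by blast
        next
          case False
          then have "?P a (a # p) t'" using p step a path_append[of "[a]" p] by auto
          then show ?thesis by blast
        qed
      qed
    qed
  qed
  then show ?thesis using s that by blast
qed

lemma connected_minus: "connected_on (X \<union> Y - {a}) E"
  using two_conn unfolding two_connected_def by (cases "a \<in> X \<union> Y") auto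

text \<open>Since \<open>k < \<delta>\<close>, \<open>v\<close> has a neighbour \<open>z\<close> off
  the cycle, and deleting \<open>v\<close> leaves a path from \<open>z\<close> to some
  \<open>t\<close> on it. If \<open>z\<close> is adjacent to \<open>t\<close>, then \<open>v\<close>
  is adjacent to neither cycle neighbour of \<open>t\<close>; a longer path would give a bypass with
  two vertices of \<open>X\<close>.\<close>

lemma off_cycle_degree:
  assumes c: "mcyc c" and v: "v \<in> X" "v \<notin> set c" and deg: "2 \<le> card (nb v \<inter> set c)"
  shows "card (nb v \<inter> set c) + 2 \<le> k"
proof -
  have cyc: "cyc c" using c by (simp add: mcyc_def)
  have cV: "set c \<subseteq> X \<union> Y" using cyc by (rule cyc_vertices)
  have k2: "2 \<le> k" using degree_X_le[OF c v(1)] deg by simp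
  have "card (nb v \<inter> set c) < card (nb v)"
    using degree_X_le[OF c v(1)] min_degree[OF v(1)] k_less card_X by linarith
  then obtain z where z: "E v z" "z \<notin> set c" by (metis Int_absorb2 mem_Collect_eq nat_neq_iff subsetI)
  have zY: "z \<in> Y" using z v edge_from_X by blast
  have t0: "hd c \<in> set c" using cyc by (simp add: cyc_def)
  have U: "z \<in> X \<union> Y - {v}" "hd c \<in> X \<union> Y - {v}" using zY t0 cV v not_X_and_Y by auto
  obtain p t where p: "p \<noteq> []" "hd p = z" "path p" "set p \<inter> set c = {}" "set p \<subseteq> X \<union> Y - {v}"
    "t \<in> set c" "t \<in> X \<union> Y - {v}" "E (last p) t"
    by (rule reach[OF connected_minus U(1) z(2) U(2) t0])
  show ?thesis
  proof (cases "tl p = []")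
    case True
    then have "p = [z]" using p by (cases p) auto
    then have zt: "E z t" using p by simp
    obtain l r where lr: "c = l @ t # r" using p(6) by (meson split_list)
    define c1 where "c1 = r @ l"
    have m1: "mcyc ([t] @ c1)" and m2: "mcyc (c1 @ [t])"
      using mcyc_rotate[of l "t # r"] mcyc_rotate[of "l @ [t]" r] c lr by (simp_all add: c1_def)
    have s: "set ([t] @ c1) = set c" "set (c1 @ [t]) = set c" using lr by (auto simp: c1_def)
    have "length ([t] @ c1) = 2 * k" using cyc_card(2)[of "[t] @ c1"] m1 by (simp add: mcyc_def)
    then have len: "length c1 \<ge> 3" using k2 by simp
    then have ne: "c1 \<noteq> []" by auto
    have d: "distinct ([t] @ c1)" "path ([t] @ c1)" "path (c1 @ [t])"
      using m1 m2 by (auto simp: mcyc_def cyc_alt path_def)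
    have e: "E t (hd c1)" "E (last c1) t"
      using m1 m2 ne by (auto simp: mcyc_def cyc_alt path_append)
    have tX: "t \<in> X" using zt zY edge_from_Y by blast
    have Y: "hd c1 \<in> Y" "last c1 \<in> Y" using e tX edge_from_X edge_to_X by blast+
    have zv: "path [z, v]" "path [v, z]" using z E_sym[OF z(1)] zY v not_X_and_Y by (auto simp: path_def)
    have zs: "z \<noteq> t" "z \<notin> set c1" "v \<noteq> t" "v \<notin> set c1" using s(1) z(2) v(2) by auto
    \<comment> \<open>Otherwise \<open>z\<close> and \<open>v\<close> could be inserted between
      \<open>t\<close> and its successor.\<close>
    have n1: "\<not> E v (hd c1)"
    proof
      assume "E v (hd c1)"
      then have "cyc ((c1 @ [t]) @ [z, v])"
        using cyc_appendI[OF d(3) zv(1)] zs E_sym[OF zt] ne by simp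
      then show False by (rule not_larger[OF c _ _ v(1) _ v(2)]) (use s in auto)
    qed
    have n2: "\<not> E v (last c1)"
    proof
      assume "E v (last c1)"
      then have "cyc (([t] @ c1) @ [v, z])"
        using cyc_appendI[OF d(2) zv(2)] zs zt E_sym[of v "last c1"] ne by simp
      then show False by (rule not_larger[OF c _ _ v(1) _ v(2)]) (use s in auto)
    qed
    have "c1 ! 0 \<noteq> c1 ! (length c1 - 1)" using d(1) len by (subst nth_eq_iff_index_eq) auto
    then have neq: "hd c1 \<noteq> last c1" using ne by (simp add: hd_conv_nth last_conv_nth)
    have "hd c1 \<in> set c" "last c1 \<in> set c" unfolding s(1)[symmetric] using ne by simp_all
    then have in_c: "{hd c1, last c1} \<subseteq> Y \<inter> set c" using Y by simp
    have "nb v \<inter> set c \<subseteq> Y \<inter> set c - {hd c1, last c1}" using n1 n2 nb_X[OF v(1)] by auto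
    then have "card (nb v \<inter> set c) \<le> card (Y \<inter> set c - {hd c1, last c1})"
      using finite_Y by (intro card_mono) auto
    also have "\<dots> = card (Y \<inter> set c) - card {hd c1, last c1}"
      using in_c by (intro card_Diff_subset) auto
    finally have "card (nb v \<inter> set c) \<le> card (Y \<inter> set c) - card {hd c1, last c1}" .
    then show ?thesis using neq mcyc_card[OF c] k2 by simp
  next
    case False
    \<comment> \<open>The second vertex of \<open>p\<close> lies in \<open>X\<close> and differs
      from \<open>v\<close>. Together with a neighbour of \<open>v\<close> on the cycle other than
      \<open>t\<close>, \<open>v # p\<close> becomes a double bypass.\<close>
    obtain w q where pq: "p = z # w # q" using False p(1,2) by (cases p; cases "tl p") auto
    have w: "w \<in> X" "w \<noteq> v"
      using p(3,5) pq zY edge_from_Y by (auto simp: path_def)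
    have "\<not> nb v \<inter> set c \<subseteq> {t}"
    proof
      assume "nb v \<inter> set c \<subseteq> {t}"
      then have "card (nb v \<inter> set c) \<le> card {t}" by (intro card_mono) auto
      then show False using deg by simp
    qed
    then obtain t' where t': "E v t'" "t' \<in> set c" "t' \<noteq> t" by auto
    have R: "path (v # p)" using p(1,2,3,5) z path_append[of "[v]" p] by auto
    obtain A d B e where "config A d B e (v # p)"
    proof (rule config_exists[OF c t'(2) p(6) t'(3) R])
      show "set (v # p) \<inter> set c = {}" using p(4) v by auto
      show "X \<inter> set (v # p) \<noteq> {}" using v by auto
      show "E t' (hd (v # p))" "E t (last (v # p))" using t' p(1,8) E_sym by auto
    qed auto
    moreover have "2 \<le> card (X \<inter> set (v # p))"
    proof -
      have "card {v, w} = 2" using w by auto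
      moreover have "{v, w} \<subseteq> X \<inter> set (v # p)" using v w pq by auto
      ultimately show ?thesis using finite_X card_mono by (metis finite_Int)
    qed
    ultimately show ?thesis using no_double_bypass by blast
  qed
qed


section \<open>Vertices missed by an extremal cycle\<close>

text \<open>On the path from \<^term>\<open>hd A\<close> to \<^term>\<open>hd B\<close> through \<^term>\<open>v\<close> consider the positions whose left and
  right neighbours are adjacent to the far and the near end. Each such vertex is left out by another
  maximal cycle, and together with the ends of the path these vertices have pairwise no common
  neighbour outside the cycle.\<close>

lemma pair_degree:
  assumes c: "config A [] B [] [v]"
  defines "S \<equiv> set (A @ B)"
  shows "2 * card (nb (hd A) \<inter> S) + 2 * card (nb (hd B) \<inter> S) \<le> 2 * k + 1 + card (nb v \<inter> S)"
proof -
  note p = config_paths[OF c]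
  let ?deg = "\<lambda>u. card (nb u \<inter> S)"
  have v: "v \<in> X" "v \<notin> S" using p(5,6,35) by (auto simp: S_def)
  have m: "mcyc (A @ B)" using p(31) by simp
  have YS: "card (Y \<inter> S) = k" using mcyc_card[OF m] by (simp add: S_def)
  define P where "P = A @ [v] @ rev B"
  define n where "n = length P"
  have pathP: "path P"
    unfolding P_def path_append using p(1,2,4,14,15,19,20) v E_sym by (auto simp: hd_rev S_def)
  have setP: "set P = insert v S" by (auto simp: P_def S_def)
  have ends: "hd P = hd A" "last P = hd B" "P \<noteq> []" using p(14,15) by (auto simp: P_def last_rev)
  have n: "n \<ge> 3" "0 < n" using p(14,15) by (cases A; cases B; auto simp: n_def P_def)+
  have nth: "P ! 0 = hd P" "P ! (n - 1) = last P" using ends by (simp_all add: hd_conv_nth last_conv_nth n_def)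
  have adj: "E (P ! i) (P ! Suc i)" if "Suc i < n" for i
    using pathP that by (auto simp: path_def n_def successively_nth)
  have distP: "distinct P" using pathP by (simp add: path_def)
  have hX: "hd P \<in> X" "last P \<in> X" using ends p(17,18) by auto
  \<comment> \<open>Any rearrangement of \<open>P\<close> into a path \<open>L\<close> with ends in
    \<open>X\<close> separates its ends: a common neighbour off \<open>S\<close> would close
    \<open>L\<close> to a cycle with \<open>k + 1\<close> vertices of \<open>X\<close>.\<close>
  have sep: "nb (hd L) \<inter> nb (last L) \<subseteq> S" if L: "path L" "set L = set P" "hd L \<in> X" for L
  proof
    fix z assume z: "z \<in> nb (hd L) \<inter> nb (last L)"
    show "z \<in> S"
    proof (rule ccontr)
      assume zS: "z \<notin> S"
      have "z \<in> Y" using z L(3) edge_from_X by auto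
      then have "z \<notin> set L" using L(2) setP zS v not_X_and_Y by auto
      moreover have "L \<noteq> []" using L(2) ends by auto
      ultimately have "cyc (L @ [z])" using cyc_appendI[OF L(1), of "[z]"] z E_sym by simp
      then show False using not_larger[OF m, of "L @ [z]" v] v L(2) setP by (auto simp: S_def)
    qed
  qed
  define J where "J = {i. 0 < i \<and> Suc i < n \<and> E (hd P) (P ! Suc i) \<and> E (last P) (P ! (i - 1))}"
  define K where "K = insert 0 (insert (n - 1) J)"
  have finJ: "finite J" by (rule finite_subset[of _ "{..<n}"]) (auto simp: J_def)
  have PX: "P ! i \<in> X" if "i \<in> K" for i
  proof -
    have "P ! i \<in> X" if "i \<in> J"
      using that adj[of i] edge_from_X[OF _ hX(1)] edge_to_Y by (auto simp: J_def)
    then show ?thesis using that hX nth by (auto simp: K_def)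
  qed
  have sepK: "nb (P ! i) \<inter> nb (P ! j) \<subseteq> S" if ij: "i \<in> K" "j \<in> K" "i < j" for i j
  proof -
    have jn: "j < n" using ij(2) n by (auto simp: K_def J_def)
    have i1: "E (hd P) (P ! Suc i)" using ij adj[of 0] nth n by (auto simp: K_def J_def)
    have j1: "E (last P) (P ! (j - 1))"
    proof (cases "j \<in> J")
      case True
      then show ?thesis by (simp add: J_def)
    next
      case False
      then have j: "j = n - 1" using ij by (auto simp: K_def)
      have "Suc (n - 2) = n - 1" "j - 1 = n - 2" using n j by simp_all
      then show ?thesis using adj[of "n - 2"] n nth(2) E_sym by simp
    qed
    have "\<not> E (P ! i) (P ! j)" using PX ij edge_from_X not_X_and_Y by blast
    \<comment> \<open>Both vertices lie in \<open>X\<close>, hence are not consecutive, and the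
      middle piece \<open>M\<close> is nonempty.\<close>
    then have ij': "Suc i < j" using adj[of i] ij jn by (metis Suc_lessI order.strict_trans1 less_or_eq_imp_le)
    define M where "M = drop (Suc i) (take j P)"
    have P: "P = take (Suc i) P @ M @ drop j P"
      using ij by (simp add: M_def) (metis Suc_leI append.assoc append_take_drop_id min.absorb1 take_take)
    have "path (take (Suc i) P @ M @ drop j P)" using pathP P by simp
    then have pp: "path (take (Suc i) P)" "path M" "path (drop j P)" "set (take (Suc i) P) \<inter> set M = {}"
      "set (take (Suc i) P) \<inter> set (drop j P) = {}" "set M \<inter> set (drop j P) = {}"
      unfolding path_append set_append by blast+
    have ne: "take (Suc i) P \<noteq> []" "M \<noteq> []" "drop j P \<noteq> []" using ij' jn ends by (auto simp: M_def n_def)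
    have hM: "hd M = P ! Suc i" using ij' jn by (simp add: M_def hd_drop_conv_nth n_def)
    have "last M = last (take j P)" using ij' jn by (simp add: M_def last_drop n_def)
    then have lM: "last M = P ! (j - 1)" using ij' jn ends by (simp add: last_conv_nth n_def min_def)
    have lt: "last (take (Suc i) P) = P ! i" using ij' jn ends by (simp add: last_conv_nth n_def min_def)
    have hdj: "hd (drop j P) = P ! j" using jn by (simp add: hd_drop_conv_nth n_def)
    have ldj: "last (drop j P) = last P" using jn by (simp add: last_drop n_def)
    have ht: "hd (take (Suc i) P) = hd P" by simp
    \<comment> \<open>From \<open>P ! i\<close> back to \<open>hd P\<close>, over to
      \<open>P ! Suc i\<close>, forward to \<open>P ! (j - 1)\<close>, over to \<open>last P\<close>
      and back to \<open>P ! j\<close>. For \<open>i = 0\<close> or \<open>j = n - 1\<close> the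
      corresponding jump is an edge of \<open>P\<close>.\<close>
    let ?L = "rev (take (Suc i) P) @ (M @ rev (drop j P))"
    have "path (M @ rev (drop j P))"
      unfolding path_append[of M] using pp ne lM ldj j1 E_sym by (simp add: hd_rev)
    then have "path ?L"
      unfolding path_append[of "rev (take (Suc i) P)"] using pp ne hM ht i1 by (auto simp: last_rev)
    moreover have "set P = set (take (Suc i) P) \<union> set M \<union> set (drop j P)" by (metis P set_append Un_assoc)
    then have "set ?L = set P" by auto
    moreover have "hd ?L = P ! i" "last ?L = P ! j" using ne lt hdj by (simp_all add: hd_rev last_rev)
    ultimately show ?thesis using sep[of ?L] PX ij by simp
  qed
  have injP: "inj_on ((!) P) K"
    using distP n by (intro inj_on_nth) (auto simp: K_def J_def n_def)
  have notin: "0 \<notin> insert (n - 1) J" "n - 1 \<notin> J" using n by (auto simp: J_def)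
  have cardK: "card K = card J + 2" using notin finJ by (simp add: K_def)
  have "card ((!) P ` K) * \<delta> + k + 5 \<le> (\<Sum>u\<in>(!) P ` K. ?deg u) + 3 * \<delta>"
  proof (rule degree_sum)
    show "(!) P ` K \<subseteq> X" using PX by auto
    show "card (Y \<inter> S) = k" by (fact YS)
    fix u w assume "u \<in> (!) P ` K" "w \<in> (!) P ` K" "u \<noteq> w"
    then obtain i j where ij: "i \<in> K" "j \<in> K" "u = P ! i" "w = P ! j" "i \<noteq> j" by auto
    then show "nb u \<inter> nb w \<subseteq> S" using sepK[of i j] sepK[of j i] by (metis Int_commute nat_neq_iff)
  qed
  moreover have "(\<Sum>u\<in>(!) P ` K. ?deg u) = ?deg (hd A) + (?deg (hd B) + (\<Sum>i\<in>J. ?deg (P ! i)))"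
    unfolding sum.reindex[OF injP] using notin finJ nth ends by (simp add: K_def)
  ultimately have sum: "(card J + 2) * \<delta> + k + 5 \<le>
      ?deg (hd A) + (?deg (hd B) + (\<Sum>i\<in>J. ?deg (P ! i))) + 3 * \<delta>"
    using card_image[OF injP] cardK by simp
  have degP: "card (nb u \<inter> set P) = ?deg u" if "u \<in> X" for u
  proof -
    have "nb u \<inter> set P = nb u \<inter> S" using setP v nb_X[OF that] not_X_and_Y by auto
    then show ?thesis by simp
  qed
  have "card (Y \<inter> set P) = k"
  proof -
    have "Y \<inter> set P = Y \<inter> S" using setP v not_X_and_Y by auto
    then show ?thesis using YS by simp
  qed
  then have ub: "?deg (hd A) + ?deg (hd B) \<le> k + 1 + card J"
    using card_shifted_neighbours[OF pathP hX(1) hX(1) hX(2)] degP hX ends unfolding J_def n_def by simp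
  \<comment> \<open>\<open>v\<close> is itself exchangeable: the edges between the arcs on the
    original cycle are its crossing.\<close>
  have vJ: "length A \<in> J" and Pv: "P ! length A = v"
  proof -
    show "P ! length A = v" by (simp add: P_def)
    have "P ! Suc (length A) = last B"
      using p(15) by (simp add: P_def nth_append rev_nth last_conv_nth)
    moreover have "P ! (length A - 1) = last A"
      using p(14) by (simp add: P_def nth_append last_conv_nth)
    ultimately show "length A \<in> J"
      using p(14,15,26,28) ends E_sym by (simp add: J_def n_def P_def)
  qed
  have degJ: "?deg (P ! i) + 2 \<le> k" if i: "i \<in> J" for i
  proof -
    have i': "0 < i" "Suc i < n" "E (hd P) (P ! Suc i)" "E (last P) (P ! (i - 1))" using i by (auto simp: J_def)
    \<comment> \<open>The two crossing edges close \<open>P\<close> without \<open>P ! i\<close> to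
      another extremal cycle. It misses \<open>P ! i\<close> but contains both of its neighbours on
      \<open>P\<close>, so \<open>off_cycle_degree\<close> applies.\<close>
    let ?c = "take i P @ rev (drop (Suc i) P)"
    have split: "P = take i P @ [P ! i] @ drop (Suc i) P" using i' by (simp add: id_take_nth_drop n_def)
    have "path (take i P @ [P ! i] @ drop (Suc i) P)" using pathP split by simp
    then have pp: "path (take i P)" "path (drop (Suc i) P)" "set (take i P) \<inter> set (drop (Suc i) P) = {}"
      "P ! i \<notin> set (take i P)" "P ! i \<notin> set (drop (Suc i) P)"
      unfolding path_append set_append by (blast, blast, blast, simp_all)
    have ne: "take i P \<noteq> []" "drop (Suc i) P \<noteq> []" using i' ends by (auto simp: n_def)
    have "cyc ?c"
    proof (rule cyc_appendI)
      show "E (last (take i P)) (hd (rev (drop (Suc i) P)))"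
        using i' ne E_sym by (simp add: hd_rev last_drop n_def last_conv_nth[of "take i P"] min_def)
      show "E (last (rev (drop (Suc i) P))) (hd (take i P))"
        using i' ne E_sym by (simp add: last_rev hd_drop_conv_nth n_def)
    qed (use pp ne in auto)
    have "set P = insert (P ! i) (set ?c)" by (subst split) auto
    moreover have notc: "P ! i \<notin> set ?c" using pp by simp
    ultimately have sc: "set ?c = insert v S - {P ! i}" using setP by auto
    have wX: "P ! i \<in> X" using PX i by (simp add: K_def)
    have wP: "P ! i \<in> insert v S" using setP nth_mem[of i P] i' by (auto simp: n_def)
    have "X \<inter> set ?c = insert v (X \<inter> S) - {P ! i}" using sc v wX by auto
    moreover have "card (insert v (X \<inter> S)) = Suc k" using v m finite_X by (simp add: mcyc_def S_def)
    ultimately have "card (X \<inter> set ?c) = k"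
      using wX wP finite_X by (simp add: card_Diff_singleton)
    then have mc: "mcyc ?c" using \<open>cyc ?c\<close> by (simp add: mcyc_def)
    have eq: "nb (P ! i) \<inter> set ?c = nb (P ! i) \<inter> S"
      using sc nb_X[OF wX] v wX not_X_and_Y by auto
    have "E (P ! i) (P ! (i - 1))" "E (P ! i) (P ! Suc i)"
      using adj[of "i - 1"] adj[of i] i' E_sym by auto
    moreover have "P ! (i - 1) \<noteq> P ! Suc i" using distP i' by (simp add: nth_eq_iff_index_eq n_def)
    moreover have "P ! (i - 1) \<in> set ?c" "P ! Suc i \<in> set ?c"
    proof -
      have "P ! (i - 1) \<in> set P" "P ! Suc i \<in> set P" "P ! (i - 1) \<noteq> P ! i" "P ! Suc i \<noteq> P ! i"
        using distP i' by (auto simp: nth_eq_iff_index_eq n_def)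
      then show "P ! (i - 1) \<in> set ?c" "P ! Suc i \<in> set ?c" using sc setP by auto
    qed
    ultimately have "{P ! (i - 1), P ! Suc i} \<subseteq> nb (P ! i) \<inter> set ?c" "card {P ! (i - 1), P ! Suc i} = 2"
      by auto
    then have "2 \<le> card (nb (P ! i) \<inter> set ?c)" using finite_nb card_mono by (metis finite_Int)
    then show ?thesis using off_cycle_degree[OF mc wX notc] eq by simp
  qed
  have "(\<Sum>i\<in>J. ?deg (P ! i)) = ?deg v + (\<Sum>i\<in>J - {length A}. ?deg (P ! i))"
    using vJ Pv finJ by (simp add: sum.remove)
  moreover have "(\<Sum>i\<in>J - {length A}. ?deg (P ! i) + 2) \<le> (\<Sum>i\<in>J - {length A}. k)"
    using degJ by (intro sum_mono) auto
  then have "(\<Sum>i\<in>J - {length A}. ?deg (P ! i)) + card (J - {length A}) * 2 \<le> card (J - {length A}) * k"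
    by (simp only: sum.distrib sum_constant of_nat_id)
  moreover obtain w where w: "card J = Suc w" using vJ finJ by (metis card_gt_0_iff empty_iff gr0_implies_Suc)
  moreover have "card (J - {length A}) = w" using w vJ by simp
  ultimately have up: "(\<Sum>i\<in>J. ?deg (P ! i)) + 2 * w \<le> ?deg v + w * k" by simp
  \<comment> \<open>With \<open>card J = w + 1\<close>, the sum of the degrees of
    \<open>hd A\<close>, \<open>hd B\<close> and \<open>v\<close> is at least
    \<open>3 * w + k + 5\<close>; three times \<open>ub\<close> then eliminates
    \<open>w\<close>.\<close>
  have "w * (k + 1) \<le> w * \<delta>" using k_less card_X by (intro mult_le_mono2) simp
  then have "w * k + w \<le> w * \<delta>" by simp
  moreover have "w * \<delta> + k + 5 \<le> ?deg (hd A) + (?deg (hd B) + (\<Sum>i\<in>J. ?deg (P ! i)))"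
    using sum w by (simp add: algebra_simps)
  ultimately show ?thesis using up ub w by linarith
qed

text \<open>The successors of the neighbours of \<open>v\<close> must in total have nearly full
  degree on the cycle, while \<open>pair_degree\<close> makes every pair of them lose a fixed
  amount. Two disjoint pairs already lose too much.\<close>

lemma off_cycle_degree_le_1:
  assumes c: "mcyc c" and v: "v \<in> X" "v \<notin> set c"
  shows "card (nb v \<inter> set c) \<le> 1"
proof (rule ccontr)
  let ?deg = "\<lambda>u. card (nb u \<inter> set c)"
  assume "\<not> ?deg v \<le> 1"
  then have a2: "2 \<le> ?deg v" by simp
  have cyc: "cyc c" using c by (simp add: mcyc_def)
  have dist: "distinct c" using cyc by (simp add: cyc_def)
  define J where "J = {i. i < length c \<and> E v (c ! i)}"
  have finJ: "finite J" by (simp add: J_def)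
  have "nb v \<inter> set c = (!) c ` J" by (auto simp: J_def in_set_conv_nth)
  moreover have "J \<subseteq> {..<length c}" by (auto simp: J_def)
  ultimately have cJ: "card J = ?deg v" using card_nth_image[OF dist] by simp
  define u where "u i = c ! (Suc i mod length c)" for i
  have inj: "inj_on u J"
    unfolding u_def by (rule inj_on_subset[OF next_inj[OF cyc]]) (auto simp: J_def)
  have pair: "\<exists>A B. clean_config A [] B [] [v] \<and> set (A @ B) = set c \<and> hd A = u i \<and> hd B = u j"
    if "i \<in> J" "j \<in> J" "i \<noteq> j" for i j
    using successors_config[OF c v] that by (simp add: J_def u_def)
  have pair_le: "2 * ?deg (u i) + 2 * ?deg (u j) \<le> 2 * k + 1 + ?deg v" if "i \<in> J" "j \<in> J" "i \<noteq> j" for i j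
    using pair[OF that] pair_degree by (metis clean_config_def)
  have sep: "nb (u i) \<inter> nb (u j) \<subseteq> set c" "nb v \<inter> nb (u i) \<subseteq> set c" if ij: "i \<in> J" "j \<in> J" "i \<noteq> j" for i j
  proof -
    obtain A B where AB: "clean_config A [] B [] [v]" "set (A @ B) = set c" "hd A = u i" "hd B = u j"
      using pair[OF ij] by blast
    show "nb (u i) \<inter> nb (u j) \<subseteq> set c" using clean_separated[OF AB(1)] AB by simp
    show "nb v \<inter> nb (u i) \<subseteq> set c" using clean_separated_bypass[OF AB(1) v(1)] AB by simp
  qed
  have sepv: "nb v \<inter> nb (u i) \<subseteq> set c" if i: "i \<in> J" for i
  proof -
    have "card (J - {i}) > 0" using a2 cJ finJ i by (simp add: card_Diff_singleton)
    then obtain j where "j \<in> J - {i}" by (metis all_not_in_conv card.empty less_numeral_extra(3))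
    then show ?thesis using sep(2)[OF i] by auto
  qed
  have uX: "u i \<in> X" and uc: "u i \<in> set c" if "i \<in> J" for i
  proof -
    have i: "i < length c" "E v (c ! i)" using that by (auto simp: J_def)
    show "u i \<in> X" using cyc_next[OF cyc i(1)] edge_from_X[OF i(2) v(1)] edge_from_Y by (simp add: u_def)
    have "Suc i mod length c < length c" using i by (intro mod_less_divisor) auto
    then show "u i \<in> set c" by (simp add: u_def)
  qed
  have vu: "v \<notin> u ` J" using uc v by auto
  have "card (insert v (u ` J)) * \<delta> + k + 5 \<le> (\<Sum>w\<in>insert v (u ` J). ?deg w) + 3 * \<delta>"
  proof (rule degree_sum)
    show "insert v (u ` J) \<subseteq> X" using v uX by auto
    show "card (Y \<inter> set c) = k" using c by (rule mcyc_card)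
    fix x y assume "x \<in> insert v (u ` J)" "y \<in> insert v (u ` J)" "x \<noteq> y"
    then show "nb x \<inter> nb y \<subseteq> set c" using sep(1) sepv by auto
  qed
  then have "(card J + 1) * \<delta> + k + 5 \<le> ?deg v + (\<Sum>i\<in>J. ?deg (u i)) + 3 * \<delta>"
    using vu finJ card_image[OF inj] by (simp add: sum.reindex[OF inj])
  moreover obtain b where b: "card J = b + 2" using a2 cJ by (metis le_Suc_ex add.commute)
  moreover have "b * (k + 1) \<le> b * \<delta>" using k_less card_X by (intro mult_le_mono2) simp
  ultimately have "card J * k + 3 \<le> (\<Sum>i\<in>J. ?deg (u i)) + k" using cJ by (simp add: algebra_simps)
  \<comment> \<open>No degree exceeds \<open>k\<close>, so the total shortfall, at most
    \<open>k - 3\<close>, bounds that of every subset.\<close>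
  then have sub: "card K * k + 3 \<le> (\<Sum>i\<in>K. ?deg (u i)) + k" if "K \<subseteq> J" for K
  proof -
    have "(\<Sum>i\<in>J. ?deg (u i)) = (\<Sum>i\<in>K. ?deg (u i)) + (\<Sum>i\<in>J - K. ?deg (u i))"
      using sum.subset_diff[OF that finJ, of "\<lambda>i. ?deg (u i)"] by simp
    moreover have "(\<Sum>i\<in>J - K. ?deg (u i)) \<le> (\<Sum>i\<in>J - K. k)"
      using degree_X_le[OF c] uX by (intro sum_mono) auto
    moreover have "card J * k = card K * k + card (J - K) * k"
      using that finJ by (metis add_mult_distrib card_Diff_subset card_mono finite_subset le_add_diff_inverse)
    ultimately show ?thesis using \<open>card J * k + 3 \<le> (\<Sum>i\<in>J. ?deg (u i)) + k\<close> by simp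
  qed
  have le: "?deg v + 2 \<le> k" using off_cycle_degree[OF c v a2] .
  obtain K where K: "K \<subseteq> J" "card K = 2" using a2 cJ obtain_subset_with_card_n by metis
  then obtain i j where ij: "K = {i, j}" "i \<noteq> j" by (meson card_2_iff)
  \<comment> \<open>A single pair shows that \<open>v\<close> has enough neighbours for two disjoint
    pairs.\<close>
  have "2 * k + 3 \<le> ?deg (u i) + ?deg (u j) + k" using sub[OF K(1)] K ij by simp
  moreover have "2 * ?deg (u i) + 2 * ?deg (u j) \<le> 2 * k + 1 + ?deg v" using pair_le K ij by auto
  ultimately have "4 \<le> card J" using cJ by linarith
  then obtain L where L: "L \<subseteq> J" "card L = 4" using obtain_subset_with_card_n by metis
  have finL: "finite L" using L finJ finite_subset by blast
  have "2 \<le> card L" using L by simp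
  then obtain L1 where L1: "L1 \<subseteq> L" "card L1 = 2" by (meson obtain_subset_with_card_n)
  have "card (L - L1) = 2" using L L1 finL by (simp add: card_Diff_subset finite_subset)
  then obtain i' j' where ij': "L - L1 = {i', j'}" "i' \<noteq> j'" by (meson card_2_iff)
  obtain i j where ij: "L1 = {i, j}" "i \<noteq> j" using L1(2) by (meson card_2_iff)
  have "(\<Sum>i\<in>L. ?deg (u i)) = (\<Sum>i\<in>L - L1. ?deg (u i)) + (\<Sum>i\<in>L1. ?deg (u i))"
    by (rule sum.subset_diff[OF L1(1) finL])
  \<comment> \<open>Adding both pair bounds gives \<open>3 * k + 3 \<le> 2 * k + 1 + ?deg v\<close>,
    which contradicts \<open>le\<close>.\<close>
  then have "4 * k + 3 \<le> ?deg (u i') + ?deg (u j') + (?deg (u i) + ?deg (u j)) + k"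
    using sub[OF L(1)] L(2) ij ij' by simp
  moreover have "2 * ?deg (u i) + 2 * ?deg (u j) \<le> 2 * k + 1 + ?deg v"
    using pair_le L L1 ij by blast
  moreover have "2 * ?deg (u i') + 2 * ?deg (u j') \<le> 2 * k + 1 + ?deg v"
    using pair_le L ij' by blast
  ultimately show False using le by linarith
qed

text \<open>A path from a missed vertex reaches the cycle at \<open>t\<close> from
  \<open>?q\<close>, and deleting \<open>t\<close> gives a second way from \<open>?q\<close> to the
  cycle. If that way avoids \<open>X\<close>, it is \<open>?q\<close> alone; then deleting
  \<open>?q\<close> leads from its predecessor \<open>v\<close> in \<open>X\<close> to the cycle,
  and one of \<open>t\<close>, \<open>t'\<close> differs from the endpoint.\<close>

lemma bypass_exists:
  assumes c: "mcyc c"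
  obtains t t' R where "t \<in> set c" "t' \<in> set c" "t \<noteq> t'" "path R" "R \<noteq> []" "set R \<inter> set c = {}"
    "X \<inter> set R \<noteq> {}" "E t (hd R)" "E t' (last R)"
proof -
  have cyc: "cyc c" using c by (simp add: mcyc_def)
  have cV: "set c \<subseteq> X \<union> Y" using cyc by (rule cyc_vertices)
  have hl: "hd c \<in> set c" "last c \<in> set c" "hd c \<noteq> last c"
    using cyc edge[of "last c" "hd c"] not_X_and_Y by (auto simp: cyc_def)
  have other: "\<exists>s\<in>set c. s \<in> X \<union> Y - {a}" for a using hl cV by (metis DiffI singletonD subsetD)
  have "\<not> X \<subseteq> set c"
    using c k_less by (auto simp: mcyc_def Int_absorb2)
  then obtain x0 where x0: "x0 \<in> X" "x0 \<notin> set c" by auto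
  have conn: "connected_on (X \<union> Y) E" using two_conn by (simp add: two_connected_def)
  obtain p t where p: "p \<noteq> []" "hd p = x0" "path p" "set p \<inter> set c = {}" "set p \<subseteq> X \<union> Y"
    "t \<in> set c" "t \<in> X \<union> Y" "E (last p) t"
    by (rule reach[OF conn _ x0(2) _ hl(1)]) (use x0 cV hl in auto)
  let ?q = "last p"
  have q: "?q \<in> X \<union> Y" "?q \<notin> set c" "?q \<noteq> t" using p(4,5,6) last_in_set[OF p(1)] by auto
  obtain s where s: "s \<in> set c" "s \<in> X \<union> Y - {t}" using other by blast
  obtain p' t' where p': "p' \<noteq> []" "hd p' = ?q" "path p'" "set p' \<inter> set c = {}" "set p' \<subseteq> X \<union> Y - {t}"
    "t' \<in> set c" "t' \<in> X \<union> Y - {t}" "E (last p') t'"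
    by (rule reach[OF connected_minus _ q(2) s(2,1)]) (use q in auto)
  have tt: "E t (hd p')" "E t' (last p')" "t \<noteq> t'" using p(8) p'(2,7,8) E_sym by auto
  show ?thesis
  proof (cases "X \<inter> set p' = {}")
    case False
    then show ?thesis using that[of t t' p'] p p' tt by blast
  next
    case True
    have single: "p' = [?q]"
    proof (rule ccontr)
      assume "p' \<noteq> [?q]"
      then obtain b r where b: "p' = ?q # b # r" using p'(1,2) by (cases p'; cases "tl p'") auto
      then have "E ?q b" using p'(3) by (simp add: path_def)
      then have "?q \<in> X \<or> b \<in> X" using edge by blast
      then show False using True b by auto
    qed
    then have qY: "?q \<in> Y" using True q(1) p'(1,2) by auto
    have "p \<noteq> [?q]" using p(1,2) x0 qY not_X_and_Y by (metis list.sel(1))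
    then obtain l v where l: "p = l @ [v, ?q]"
      using p(1) by (metis append_butlast_last_id append.assoc append_Cons append_Nil)
    have "path ([v, ?q])" using p(3) l by (metis path_append)
    then have vq: "E v ?q" by (simp add: path_def)
    then have v: "v \<in> X" using qY edge_to_Y by blast
    have "v \<in> set p" by (subst l) simp
    then have vc: "v \<notin> set c" "v \<in> X \<union> Y - {?q}" using p(4) v qY not_X_and_Y by auto
    obtain s where s: "s \<in> set c" "s \<in> X \<union> Y - {?q}" using other by blast
    obtain p2 t2 where p2: "p2 \<noteq> []" "hd p2 = v" "path p2" "set p2 \<inter> set c = {}" "set p2 \<subseteq> X \<union> Y - {?q}"
      "t2 \<in> set c" "t2 \<in> X \<union> Y - {?q}" "E (last p2) t2"
      by (rule reach[OF connected_minus vc(2,1) s(2,1)])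
    have R: "path (?q # p2)" using p2(1,2,3,5) vq E_sym path_append[of "[?q]" p2] by auto
    obtain t1 where t1: "t1 \<in> set c" "t1 \<noteq> t2" "E t1 ?q"
      using tt p(6,8) p'(6) single E_sym by (metis last.simps)
    have "v \<in> set p2" using p2(1,2) hd_in_set by metis
    then show ?thesis
      using that[OF t1(1) p2(6) t1(2) R] t1 p2 q v E_sym by auto
  qed
qed

lemma no_deficient_graph: False
proof -
  obtain c where c: "mcyc c" using attained by (auto simp: mcyc_def)
  obtain t t' R where "t \<in> set c" "t' \<in> set c" "t \<noteq> t'" "path R" "R \<noteq> []" "set R \<inter> set c = {}"
    "X \<inter> set R \<noteq> {}" "E t (hd R)" "E t' (last R)"
    by (rule bypass_exists[OF c])
  then obtain A d B e where "config A d B e R" using config_exists[OF c] by metis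
  then obtain A d B e R where cc: "clean_config A d B e R" by (rule clean_config_exists)
  then have conf: "config A d B e R" by (simp add: clean_config_def)
  note p = config_paths[OF conf]
  obtain v where v: "v \<in> X" "v \<in> set R" using p(35) by auto
  \<comment> \<open>The bypass has exactly one vertex of \<open>X\<close>, so a crossing yields
    another extremal cycle. It misses \<open>A ! i\<close> but contains its two neighbours on
    \<open>A\<close>.\<close>
  have no: False if conf: "config A d B e R" and i: "0 < i" "Suc i < length A" "E (hd A) (A ! Suc i)"
    "E (hd B) (A ! (i - 1))" for A d B e R i
  proof -
    note p = config_paths[OF conf]
    let ?c = "take i A @ B @ R @ rev (drop (Suc i) A)"
    note cr = crossing_cycle[OF conf i]
    have "card (X \<inter> set R) < 2" using no_double_bypass[OF conf] by fastforce
    moreover have "card (X \<inter> set R) \<noteq> 0" using p(35) finite_X by simp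
    ultimately have R1: "card (X \<inter> set R) = 1" by linarith
    have "card (X \<inter> set ?c) = card (X \<inter> set (A @ d @ B @ e) - {A ! i}) + card (X \<inter> set R)"
      unfolding cr(2) using finite_X p(5,6,23,24) by (intro card_Un_disjoint) auto
    also have "card (X \<inter> set (A @ d @ B @ e) - {A ! i}) = k - 1"
      using cr(3) i p(31) by (subst card_Diff_singleton) (auto simp: mcyc_def)
    finally have card_c: "card (X \<inter> set ?c) = k - 1 + card (X \<inter> set R)" .
    have "card (X \<inter> set ?c) = k"
    proof -
      \<comment> \<open>Shows \<open>k\<close> positive, so that the truncated \<open>k - 1\<close>
        plus one is \<open>k\<close>.\<close>
      have "A ! i \<in> X \<inter> set (A @ d @ B @ e)" using cr(3) i by auto
      then have "card (X \<inter> set (A @ d @ B @ e)) \<noteq> 0" using finite_X by auto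
      then have "k \<noteq> 0" using p(31) unfolding mcyc_def by metis
      then show ?thesis using R1 card_c by simp
    qed
    then have mc: "mcyc ?c" using cr(1) by (simp add: mcyc_def)
    have d: "distinct A" "successively E A" using p(1) by (auto simp: path_def)
    have nb: "E (A ! i) (A ! Suc i)" "E (A ! i) (A ! (i - 1))"
      using successively_nth[OF d(2), of i] successively_nth[OF d(2), of "i - 1"] i E_sym by auto
    have neq: "A ! (i - 1) \<noteq> A ! Suc i" using d i by (simp add: nth_eq_iff_index_eq)
    have "A ! (i - 1) \<in> set (take i A)" using i by (auto simp: in_set_conv_nth intro!: exI[of _ "i - 1"])
    moreover have "A ! Suc i \<in> set (drop (Suc i) A)"
      using i by (metis Cons_nth_drop_Suc list.set_intros(1))
    ultimately have "{A ! (i - 1), A ! Suc i} \<subseteq> nb (A ! i) \<inter> set ?c" using nb by auto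
    then have "card {A ! (i - 1), A ! Suc i} \<le> card (nb (A ! i) \<inter> set ?c)"
      using finite_nb by (intro card_mono) auto
    then show False using off_cycle_degree_le_1[OF mc cr(3,4)] neq by simp
  qed
  have "card (nb (hd A) \<inter> set (A @ d @ B @ e)) + card (nb (hd B) \<inter> set (A @ d @ B @ e)) \<le> k + 2"
    by (rule end_degrees_without_crossing[OF conf]) (use no[OF conf] no[OF config_sym[OF conf]] in blast)+
  then have "3 \<le> card (nb v \<inter> set (A @ d @ B @ e))" using clean_degree_sum[OF cc v] by linarith
  moreover have "v \<notin> set (A @ d @ B @ e)" using v p(5,6,23,24) by auto
  ultimately show False using off_cycle_degree_le_1[OF p(31) v(1)] by fastforce
qed

end

section \<open>The theorem, from a cycle with the most vertices of \<open>X\<close>\<close>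

theorem theorem2:
  fixes X Y :: "'a set" and E :: "'a \<Rightarrow> 'a \<Rightarrow> bool" and n m \<delta> :: nat
  assumes "bipartite_graph X Y E"
    and "card X = n" and "card Y = m" and "n \<ge> 2"
    and "n \<le> \<delta>" and "\<delta> \<le> m" and "int m \<le> 3 * int \<delta> - 5"
    and "\<forall>x\<in>X. degree E x \<ge> \<delta>"
    and "two_connected (X \<union> Y) E"
  shows "\<exists>c. is_cycle (X \<union> Y) E c \<and> length c = 2 * n \<and> X \<subseteq> set c"
proof -
  interpret bipartite X Y E
    using assms(1) by unfold_locales (auto simp: bipartite_graph_def simple_graph_def)
  define N where "N = (\<lambda>c. card (X \<inter> set c)) ` {c. cyc c}"
  have N: "finite N" by (rule finite_subset[of _ "{..card X}"]) (auto simp: N_def intro: card_mono finite_X)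
  obtain x where x: "x \<in> X" using assms(2,4) by fastforce
  have "card {w. E x w} \<noteq> 0" using assms(4,5,8) x by (fastforce simp: degree_def)
  then obtain y where "E x y" by fastforce
  \<comment> \<open>A single edge counts as a cycle, so the maximum is taken over a nonempty
    set.\<close>
  then have "cyc [x, y]" using x edge_from_X[of x y] E_sym[of x y] not_X_and_Y[of x] by (auto simp: cyc_def)
  then have "N \<noteq> {}" by (auto simp: N_def)
  then have "Max N \<in> N" using N by simp
  then obtain c where c: "cyc c" "card (X \<inter> set c) = Max N" by (auto simp: N_def)
  have max: "card (X \<inter> set c') \<le> Max N" if "cyc c'" for c' using N that by (auto simp: N_def)
  have "\<not> Max N < card X"
  proof
    assume less: "Max N < card X"
    interpret deficient X Y E \<delta> "Max N"
      using assms less max c by unfold_locales (auto simp: degree_def)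
    show False by (rule no_deficient_graph)
  qed
  moreover have "card (X \<inter> set c) \<le> card X" by (intro card_mono finite_X) auto
  ultimately have eq: "card (X \<inter> set c) = card X" using c by simp
  then have "X \<inter> set c = X" by (intro card_subset_eq finite_X) auto
  then have X: "X \<subseteq> set c" by auto
  have len: "length c = 2 * n" using cyc_card(2)[OF c(1)] eq assms(2) by simp
  have "E (c ! i) (c ! Suc i)" if "i < length c - 1" for i
    using c(1) that by (auto simp: cyc_def successively_nth)
  \<comment> \<open>By \<open>n \<ge> 2\<close> the length is at least 4, so the cycle is not a
    degenerate edge.\<close>
  then have "is_cycle (X \<union> Y) E c"
    using c(1) len assms(4) cyc_vertices[OF c(1)] by (auto simp: is_cycle_def cyc_def)
  then show ?thesis using X len by blast
qed

end
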